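(* Let $K$ be a field of characteristic not $2$, let $\Gamma$ be a finite quiver without oriented cycles, let $\rho$ be a set of relations on $\Gamma$ over $K$, and let $\mathscr{D}(\Lambda)$ be the dual extension of the algebra $\Lambda=K(\Gamma,\rho)$. Then every Lie derivation $\Theta$ of $\mathscr{D}(\Lambda)$ is of the standard form, i.e. $\Theta=D+\Delta$ where $D$ is an (associative) derivation of $\mathscr{D}(\Lambda)$ and $\Delta:\mathscr{D}(\Lambda)\to\mathcal{Z}(\mathscr{D}(\Lambda))$ is a $K$-linear map with $\Delta([x,y])=0$ for all $x,y\in\mathscr{D}(\Lambda)$. Moreover, for each Lie derivation $\Theta$ the pair $(D,\Delta)$ in such a decomposition is unique.
   Context: Lie derivations. For a unital associative algebra $\mathcal{A}$ write $[a,b]=ab-ba$ and let $\mathcal{Z}(\mathcal{A})$ be its center. A linear map $\Theta:\mathcal{A}\to\mathcal{A}$ is an (associative) derivation if $\Theta(ab)=\Theta(a)b+a\Theta(b)$ for all $a,b$, and a Lie derivation if $\Theta([a,b])=[\Theta(a),b]+[a,\Theta(b)]$ for all $a,b$. Quivers. A finite quiver $\Gamma$ has a finite vertex set $\Gamma_0$ and a finite set of arrows $\Gamma_1$; an arrow $\alpha$ goes from $s(\alpha)$ to $e(\alpha)$. A nontrivial path is a sequence of arrows $p=\alpha_n\cdots\alpha_1$ with $e(\alpha_m)=s(\alpha_{m+1})$ for $1\le m<n$; $s(p)=s(\alpha_1)$, $e(p)=e(\alpha_n)$. For each vertex $i$ there is a trivial path $e_i$ with $s(e_i)=e(e_i)=i$.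 An oriented cycle is a nontrivial path $p$ with $s(p)=e(p)$. The path algebra $K\Gamma$ has the paths as a $K$-basis, with product $xy$ of paths equal to the concatenation ($y$ first, then $x$) if $e(y)=s(x)$ and $0$ otherwise. A relation is a $K$-linear combination of paths all having the same start and the same end, each containing at least $2$ arrows. For a set $\rho$ of relations, $K(\Gamma,\rho)=K\Gamma/\langle\rho\rangle$, where $\langle\rho\rangle$ is the two-sided ideal generated by $\rho$. Dual extension. For each arrow $\alpha:j\to i$ of $\Gamma$ let $\alpha^{\ast}:i\to j$ be a new reversed arrow, and let $\Gamma_1^{\ast}$ be the set of these. For a path $p=\alpha_n\cdots\alpha_1$ put $p^{\ast}=\alpha_1^{\ast}\cdots\alpha_n^{\ast}$, extend linearly, and let $\rho^{\ast}=\{\sigma^{\ast}:\sigma\in\rho\}$. For $\Gamma$ without oriented cycles and $\Lambda=K(\Gamma,\rho)$, the dual extension $\mathscr{D}(\Lambda)$ is the path algebra of the quiver $(\Gamma_0,\Gamma_1\cup\Gamma_1^{\ast})$ modulo the relations $\rho\cup\rho^{\ast}\cup\{\alpha\beta^{\ast}\mid\alpha,\beta\in\Gamma_1\}$. *)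

theory Defs
  imports
    "HOL-Library.Poly_Mapping"
    "HOL-Computational_Algebra.Computational_Algebra"
    "Graph_Theory.Arc_Walk"
    "HOL-Algebra.Module"
    "HOL-Algebra.QuotRing"
begin

section \<open>Derivations and Lie derivations\<close>

text \<open>
  A \<open>K\<close>-algebra is a record of type \<open>('k, 'x) module\<close>, with \<open>K\<close> the whole type \<open>'k\<close>.
  The locale \<^locale>\<open>algebra\<close> is not used because it is restricted to commutative algebras.
  Maps are only relevant on the carrier.
\<close>

definition linear_map :: "('k, 'x, 'm) module_scheme \<Rightarrow> ('x \<Rightarrow> 'x) \<Rightarrow> bool" where
  "linear_map A f \<longleftrightarrow>
     f \<in> carrier A \<rightarrow> carrier A \<and>
     (\<forall>x\<in>carrier A. \<forall>y\<in>carrier A. f (x \<oplus>\<^bsub>A\<^esub> y) = f x \<oplus>\<^bsub>A\<^esub> f y) \<and>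
     (\<forall>c. \<forall>x\<in>carrier A. f (c \<odot>\<^bsub>A\<^esub> x) = c \<odot>\<^bsub>A\<^esub> f x)"

definition commutator :: "('x, 'm) ring_scheme \<Rightarrow> 'x \<Rightarrow> 'x \<Rightarrow> 'x" where
  "commutator A a b = a \<otimes>\<^bsub>A\<^esub> b \<ominus>\<^bsub>A\<^esub> b \<otimes>\<^bsub>A\<^esub> a"

definition center :: "('x, 'm) ring_scheme \<Rightarrow> 'x set" where
  "center A = {z \<in> carrier A. \<forall>a\<in>carrier A. z \<otimes>\<^bsub>A\<^esub> a = a \<otimes>\<^bsub>A\<^esub> z}"

definition derivation :: "('k, 'x, 'm) module_scheme \<Rightarrow> ('x \<Rightarrow> 'x) \<Rightarrow> bool" where
  "derivation A D \<longleftrightarrow> linear_map A D \<and>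
     (\<forall>a\<in>carrier A. \<forall>b\<in>carrier A. D (a \<otimes>\<^bsub>A\<^esub> b) = D a \<otimes>\<^bsub>A\<^esub> b \<oplus>\<^bsub>A\<^esub> a \<otimes>\<^bsub>A\<^esub> D b)"

definition lie_derivation :: "('k, 'x, 'm) module_scheme \<Rightarrow> ('x \<Rightarrow> 'x) \<Rightarrow> bool" where
  "lie_derivation A \<Theta> \<longleftrightarrow> linear_map A \<Theta> \<and>
     (\<forall>a\<in>carrier A. \<forall>b\<in>carrier A.
        \<Theta> (commutator A a b) = commutator A (\<Theta> a) b \<oplus>\<^bsub>A\<^esub> commutator A a (\<Theta> b))"

definition standard_decomposition ::
    "('k, 'x, 'm) module_scheme \<Rightarrow> ('x \<Rightarrow> 'x) \<Rightarrow> ('x \<Rightarrow> 'x) \<Rightarrow> ('x \<Rightarrow> 'x) \<Rightarrow> bool" where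
  "standard_decomposition A \<Theta> D \<Delta> \<longleftrightarrow>
     derivation A D \<and>
     linear_map A \<Delta> \<and> \<Delta> \<in> carrier A \<rightarrow> center A \<and>
     (\<forall>x\<in>carrier A. \<forall>y\<in>carrier A. \<Delta> (commutator A x y) = \<zero>\<^bsub>A\<^esub>) \<and>
     (\<forall>x\<in>carrier A. \<Theta> x = D x \<oplus>\<^bsub>A\<^esub> \<Delta> x)"

text \<open>Scalar multiplication on cosets follows the pattern of \<^const>\<open>rcoset_mult\<close>.\<close>

definition quotient_algebra ::
    "('k, 'x, 'm) module_scheme \<Rightarrow> 'x set \<Rightarrow> ('k, 'x set) module" where
  "quotient_algebra A I =
     ring.extend (A Quot I) (module.fields (\<lambda>c X. \<Union>x\<in>X. I +>\<^bsub>A\<^esub> (c \<odot>\<^bsub>A\<^esub> x)))"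

section \<open>Path algebras\<close>

text \<open>
  A path is a triple \<open>(s(p), [\<alpha>\<^sub>1, \<dots>, \<alpha>\<^sub>n], e(p))\<close>. The arrows are listed in the order in
  which they are traversed, so the path written \<open>\<alpha>\<^sub>n \<cdots> \<alpha>\<^sub>1\<close> has \<open>\<alpha>\<^sub>1\<close> at the head of its
  list. The trivial path at \<open>i\<close> is \<open>(i, [], i)\<close>.
\<close>

type_synonym ('v, 'a) path = "'v \<times> 'a list \<times> 'v"

type_synonym ('v, 'a, 'k) path_comb = "('v, 'a) path \<Rightarrow>\<^sub>0 'k"

definition paths :: "('v, 'a) pre_digraph \<Rightarrow> ('v, 'a) path set" where
  "paths G = {(u, p, v). pre_digraph.awalk G u p v}"

definition path_times ::
    "('v, 'a, 'k::field) path_comb \<Rightarrow> ('v, 'a, 'k) path_comb \<Rightarrow> ('v, 'a, 'k) path_comb" where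
  "path_times f g =
     (\<Sum>(u, p, v)\<in>Poly_Mapping.keys f. \<Sum>(u', q, v')\<in>Poly_Mapping.keys g.
        if v' = u
        then Poly_Mapping.single (u', q @ p, v)
               (Poly_Mapping.lookup f (u, p, v) * Poly_Mapping.lookup g (u', q, v'))
        else 0)"

definition path_algebra ::
    "('v, 'a) pre_digraph \<Rightarrow> ('k::field, ('v, 'a, 'k) path_comb) module" where
  "path_algebra G =
     \<lparr>carrier = {f. Poly_Mapping.keys f \<subseteq> paths G},
      mult = path_times,
      one = (\<Sum>i\<in>verts G. Poly_Mapping.single (i, [], i) 1),
      zero = 0,
      add = (+),
      smult = (\<lambda>c f. Poly_Mapping.map ((*) c) f)\<rparr>"

definition arrow :: "('v, 'a) pre_digraph \<Rightarrow> 'a \<Rightarrow> ('v, 'a, 'k::field) path_comb" where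
  "arrow G \<alpha> = Poly_Mapping.single (tail G \<alpha>, [\<alpha>], head G \<alpha>) 1"

definition is_relation :: "('v, 'a) pre_digraph \<Rightarrow> ('v, 'a, 'k::field) path_comb \<Rightarrow> bool" where
  "is_relation G r \<longleftrightarrow>
     (\<exists>u v. Poly_Mapping.keys r \<subseteq> {(u, p, v) | p. (u, p, v) \<in> paths G \<and> length p \<ge> 2})"

definition quiver_algebra ::
    "('v, 'a) pre_digraph \<Rightarrow> ('v, 'a, 'k::field) path_comb set \<Rightarrow>
     ('k, ('v, 'a, 'k) path_comb set) module" where
  "quiver_algebra G R = quotient_algebra (path_algebra G) (Idl\<^bsub>path_algebra G\<^esub> R)"

section \<open>Dual extensions\<close>

datatype 'a dual_arrow = Orig 'a | Star 'a

definition dual_quiver :: "('v, 'a) pre_digraph \<Rightarrow> ('v, 'a dual_arrow) pre_digraph" where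
  "dual_quiver G =
     \<lparr>verts = verts G,
      arcs = Orig ` arcs G \<union> Star ` arcs G,
      tail = (\<lambda>a. case a of Orig \<alpha> \<Rightarrow> tail G \<alpha> | Star \<alpha> \<Rightarrow> head G \<alpha>),
      head = (\<lambda>a. case a of Orig \<alpha> \<Rightarrow> head G \<alpha> | Star \<alpha> \<Rightarrow> tail G \<alpha>)\<rparr>"

fun orig_path :: "('v, 'a) path \<Rightarrow> ('v, 'a dual_arrow) path" where
  "orig_path (u, p, v) = (u, map Orig p, v)"

fun star_path :: "('v, 'a) path \<Rightarrow> ('v, 'a dual_arrow) path" where
  "star_path (u, p, v) = (v, rev (map Star p), u)"

definition extend_linearly ::
    "(('v, 'a) path \<Rightarrow> ('v, 'b) path) \<Rightarrow> ('v, 'a, 'k::field) path_comb \<Rightarrow> ('v, 'b, 'k) path_comb" where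
  "extend_linearly h f =
     (\<Sum>p\<in>Poly_Mapping.keys f. Poly_Mapping.single (h p) (Poly_Mapping.lookup f p))"

text \<open>
  For arrows that do not compose, \<open>\<alpha>\<beta>\<^sup>*\<close> is the zero element of the path algebra and
  contributes nothing to the generated ideal.
\<close>

definition dual_relations ::
    "('v, 'a) pre_digraph \<Rightarrow> ('v, 'a, 'k::field) path_comb set \<Rightarrow>
     ('v, 'a dual_arrow, 'k) path_comb set" where
  "dual_relations G \<rho> =
     extend_linearly orig_path ` \<rho> \<union> extend_linearly star_path ` \<rho> \<union>
     {arrow (dual_quiver G) (Orig \<alpha>) \<otimes>\<^bsub>path_algebra (dual_quiver G)\<^esub>
        arrow (dual_quiver G) (Star \<beta>) | \<alpha> \<beta>. \<alpha> \<in> arcs G \<and> \<beta> \<in> arcs G}"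

definition dual_extension ::
    "('v, 'a) pre_digraph \<Rightarrow> ('v, 'a, 'k::field) path_comb set \<Rightarrow>
     ('k, ('v, 'a dual_arrow, 'k) path_comb set) module" where
  "dual_extension G \<rho> = quiver_algebra (dual_quiver G) (dual_relations G \<rho>)"

end

theory Submission
  imports Defs
begin

text \<open>
  The dual extension \<open>A\<close> is spanned by the classes of the paths \<open>q\<^sup>*p\<close> with \<open>p\<close>, \<open>q\<close> paths of
  \<open>\<Gamma>\<close>. As \<open>\<Gamma>\<close> is acyclic, a closed nontrivial path either vanishes in \<open>A\<close> or is such a product
  \<open>q\<^sup>*p\<close> of two off-diagonal elements for the Peirce decomposition given by the idempotents \<open>e\<^sub>i\<close>, and
  then \<open>p q\<^sup>* = 0\<close>, so that \<open>q\<^sup>*p = [q\<^sup>*, p]\<close>.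

  Let \<open>\<Theta>\<close> be a Lie derivation. Subtracting the inner derivation of \<open>\<Sum>\<^sub>l \<Theta>(e\<^sub>l) e\<^sub>l\<close> makes every
  \<open>\<Theta>(e\<^sub>i)\<close> diagonal. Comparing Peirce components in \<open>\<Theta>([e\<^sub>i, x])\<close> then shows, as \<open>2 \<noteq> 0\<close>, that \<open>\<Theta>\<close>
  preserves the off-diagonal Peirce components and that every \<open>\<Theta>(e\<^sub>i)\<close> is central. With \<open>\<chi>\<^sub>i\<close> the
  character reading off the coefficient of the trivial path at \<open>i\<close>, one takes
  \<open>\<Delta>(x) = \<Sum>\<^sub>i \<chi>\<^sub>i(x) \<Theta>(e\<^sub>i)\<close>; the Lie derivation \<open>\<Theta> - \<Delta>\<close> kills the \<open>e\<^sub>i\<close>, respects the whole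
  Peirce decomposition, and is a derivation by inspection of products of basis elements.
  For uniqueness, a derivation with central values vanishing on commutators kills each \<open>e\<^sub>i\<close>, each
  off-diagonal \<open>x = [e\<^sub>i, x]\<close>, hence everything.
\<close>

section \<open>Derivations of algebras with idempotents\<close>

locale kalgebra = ring A for A :: "('k::field, 'x, 'm) module_scheme" (structure) +
  assumes smult_closed [simp, intro]: "x \<in> carrier A \<Longrightarrow> c \<odot> x \<in> carrier A"
    and smult_l_distr: "x \<in> carrier A \<Longrightarrow> (c + d) \<odot> x = c \<odot> x \<oplus> d \<odot> x"
    and smult_r_distr: "x \<in> carrier A \<Longrightarrow> y \<in> carrier A \<Longrightarrow> c \<odot> (x \<oplus> y) = c \<odot> x \<oplus> c \<odot> y"
    and smult_assoc: "x \<in> carrier A \<Longrightarrow> (c * d) \<odot> x = c \<odot> (d \<odot> x)"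
    and smult_one: "x \<in> carrier A \<Longrightarrow> 1 \<odot> x = x"
    and smult_mult_left: "x \<in> carrier A \<Longrightarrow> y \<in> carrier A \<Longrightarrow> (c \<odot> x) \<otimes> y = c \<odot> (x \<otimes> y)"
    and smult_mult_right: "x \<in> carrier A \<Longrightarrow> y \<in> carrier A \<Longrightarrow> x \<otimes> (c \<odot> y) = c \<odot> (x \<otimes> y)"
begin

lemma smult_zero_right [simp]: "c \<odot> \<zero> = \<zero>"
proof -
  have "c \<odot> \<zero> \<oplus> c \<odot> \<zero> = c \<odot> \<zero>"
    using smult_r_distr[of \<zero> \<zero> c] by simp
  then show ?thesis
    by (metis smult_closed zero_closed add.r_cancel_one')
qed

lemma smult_zero_left: "x \<in> carrier A \<Longrightarrow> 0 \<odot> x = \<zero>"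
  by (metis smult_l_distr[of x 0 0] smult_closed add.r_cancel_one' add_0)

lemma smult_minus:
  assumes "x \<in> carrier A" shows "c \<odot> (\<ominus> x) = \<ominus> (c \<odot> x)"
proof -
  have "c \<odot> x \<oplus> c \<odot> (\<ominus> x) = \<zero>"
    using assms smult_r_distr[of x "\<ominus> x" c] by (simp add: r_neg)
  then show ?thesis
    using assms by (metis a_comm a_inv_closed minus_equality smult_closed)
qed

lemma smult_a_minus:
  "x \<in> carrier A \<Longrightarrow> y \<in> carrier A \<Longrightarrow> c \<odot> (x \<ominus> y) = c \<odot> x \<ominus> c \<odot> y"
  by (simp add: minus_eq smult_r_distr smult_minus)

lemma smult_finsum:
  assumes "finite S" "f \<in> S \<rightarrow> carrier A"
  shows "c \<odot> (\<Oplus>i\<in>S. f i) = (\<Oplus>i\<in>S. c \<odot> f i)"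
  using assms
proof (induction S)
  case (insert i S)
  moreover have "f \<in> S \<rightarrow> carrier A" "f i \<in> carrier A" "(\<lambda>i. c \<odot> f i) \<in> S \<rightarrow> carrier A"
    using insert.prems by auto
  ultimately show ?case
    by (simp add: smult_r_distr)
qed simp

text \<open>The characteristic enters the abstract argument through this fact: \<open>x = -x\<close>
  gives \<open>2x = 0\<close>, and \<open>2\<close> is invertible in the field.\<close>

lemma eq_minus_imp_zero:
  assumes "(2::'k) \<noteq> 0" "x \<in> carrier A" "x = \<ominus> x" shows "x = \<zero>"
proof -
  have "2 \<odot> x = x \<oplus> x"
    using assms(2) smult_l_distr[of x 1 1] by (simp add: smult_one)
  also have "\<dots> = \<zero>"
    using assms(2,3) by (metis l_neg)
  finally have "(inverse 2 * 2) \<odot> x = \<zero>"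
    using assms(2) by (simp only: smult_assoc smult_zero_right)
  then show ?thesis
    using assms(1,2) by (simp add: smult_one)
qed

lemma minus_eq_zero_iff: "x \<in> carrier A \<Longrightarrow> y \<in> carrier A \<Longrightarrow> x \<ominus> y = \<zero> \<longleftrightarrow> x = y"
  by (metis minus_eq minus_equality minus_minus a_inv_closed r_neg)

section \<open>Linear maps, derivations and Lie derivations\<close>

lemma commutator_closed [simp, intro]:
  "x \<in> carrier A \<Longrightarrow> y \<in> carrier A \<Longrightarrow> commutator A x y \<in> carrier A"
  by (simp add: commutator_def)

lemma linear_mapD:
  assumes "linear_map A f"
  shows "x \<in> carrier A \<Longrightarrow> f x \<in> carrier A"
    and "x \<in> carrier A \<Longrightarrow> y \<in> carrier A \<Longrightarrow> f (x \<oplus> y) = f x \<oplus> f y"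
    and "x \<in> carrier A \<Longrightarrow> f (c \<odot> x) = c \<odot> f x"
  using assms by (auto simp: linear_map_def)

lemma linear_map_zero:
  assumes "linear_map A f" shows "f \<zero> = \<zero>"
  using linear_mapD[OF assms] by (metis add.r_cancel_one' l_zero zero_closed)

lemma linear_map_minus:
  assumes "linear_map A f" "x \<in> carrier A" shows "f (\<ominus> x) = \<ominus> f x"
proof -
  have "f (\<ominus> x) \<oplus> f x = \<zero>"
    using linear_mapD(2)[OF assms(1), of "\<ominus> x" x] assms(2) linear_map_zero[OF assms(1)]
    by (simp add: l_neg)
  then show ?thesis
    using linear_mapD(1)[OF assms(1)] assms(2) by (metis a_inv_closed minus_equality)
qed

lemma linear_map_diff:
  assumes "linear_map A f" "x \<in> carrier A" "y \<in> carrier A"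
  shows "f (x \<ominus> y) = f x \<ominus> f y"
  using assms linear_mapD[OF assms(1)] by (simp add: minus_eq linear_map_minus)

lemma linear_map_add:
  assumes "linear_map A f" "linear_map A g" shows "linear_map A (\<lambda>x. f x \<oplus> g x)"
  unfolding linear_map_def
  using linear_mapD[OF assms(1)] linear_mapD[OF assms(2)]
  by (simp add: smult_r_distr a_ac)

lemma linear_map_sub:
  assumes "linear_map A f" "linear_map A g" shows "linear_map A (\<lambda>x. f x \<ominus> g x)"
  unfolding linear_map_def
  using linear_mapD[OF assms(1)] linear_mapD[OF assms(2)]
  by (simp add: smult_a_minus) (simp add: minus_eq minus_add a_ac)

lemma derivationD:
  assumes "derivation A D"
  shows "linear_map A D"
    and "x \<in> carrier A \<Longrightarrow> y \<in> carrier A \<Longrightarrow> D (x \<otimes> y) = D x \<otimes> y \<oplus> x \<otimes> D y"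
  using assms by (auto simp: derivation_def)

lemma lie_derivationD:
  assumes "lie_derivation A T"
  shows "linear_map A T"
    and "x \<in> carrier A \<Longrightarrow> y \<in> carrier A \<Longrightarrow>
      T (commutator A x y) = commutator A (T x) y \<oplus> commutator A x (T y)"
  using assms by (auto simp: lie_derivation_def)

text \<open>Allows an inner derivation to be subtracted from a Lie derivation without leaving the
  Lie derivations.\<close>

lemma derivation_imp_lie:
  assumes "derivation A D" shows "lie_derivation A D"
proof -
  note lin = derivationD(1)[OF assms] and D = derivationD(2)[OF assms]
  have "D (commutator A x y) = commutator A (D x) y \<oplus> commutator A x (D y)"
    if "x \<in> carrier A" "y \<in> carrier A" for x y
  proof -
    have c: "x \<in> carrier A" "y \<in> carrier A" "D x \<in> carrier A" "D y \<in> carrier A"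
      using that linear_mapD(1)[OF lin] by auto
    have "D (commutator A x y) = (D x \<otimes> y \<oplus> x \<otimes> D y) \<ominus> (D y \<otimes> x \<oplus> y \<otimes> D x)"
      using c by (simp add: commutator_def linear_map_diff[OF lin] D)
    also have "\<dots> = commutator A (D x) y \<oplus> commutator A x (D y)"
      unfolding commutator_def using c by algebra
    finally show ?thesis .
  qed
  then show ?thesis using lin by (simp add: lie_derivation_def)
qed

lemma derivation_add:
  assumes "derivation A D" "derivation A E" shows "derivation A (\<lambda>x. D x \<oplus> E x)"
proof -
  note l1 = derivationD(1)[OF assms(1)] and l2 = derivationD(1)[OF assms(2)]
  have "D (x \<otimes> y) \<oplus> E (x \<otimes> y) = (D x \<oplus> E x) \<otimes> y \<oplus> x \<otimes> (D y \<oplus> E y)"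
    if "x \<in> carrier A" "y \<in> carrier A" for x y
  proof -
    have c: "x \<in> carrier A" "y \<in> carrier A" "D x \<in> carrier A" "D y \<in> carrier A"
       "E x \<in> carrier A" "E y \<in> carrier A"
      using that linear_mapD(1)[OF l1] linear_mapD(1)[OF l2] by auto
    show ?thesis
      using derivationD(2)[OF assms(1) that] derivationD(2)[OF assms(2) that] c
      by (simp add: l_distr r_distr a_ac)
  qed
  then show ?thesis using linear_map_add[OF l1 l2] by (simp add: derivation_def)
qed

lemma derivation_sub:
  assumes "derivation A D" "derivation A E" shows "derivation A (\<lambda>x. D x \<ominus> E x)"
proof -
  note l1 = derivationD(1)[OF assms(1)] and l2 = derivationD(1)[OF assms(2)]
  have "D (x \<otimes> y) \<ominus> E (x \<otimes> y) = (D x \<ominus> E x) \<otimes> y \<oplus> x \<otimes> (D y \<ominus> E y)"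
    if "x \<in> carrier A" "y \<in> carrier A" for x y
  proof -
    have c: "x \<in> carrier A" "y \<in> carrier A" "D x \<in> carrier A" "D y \<in> carrier A"
       "E x \<in> carrier A" "E y \<in> carrier A"
      using that linear_mapD(1)[OF l1] linear_mapD(1)[OF l2] by auto
    have "(D x \<otimes> y \<oplus> x \<otimes> D y) \<ominus> (E x \<otimes> y \<oplus> x \<otimes> E y) = (D x \<ominus> E x) \<otimes> y \<oplus> x \<otimes> (D y \<ominus> E y)"
      using c by algebra
    then show ?thesis
      using derivationD(2)[OF assms(1) that] derivationD(2)[OF assms(2) that] by simp
  qed
  then show ?thesis using linear_map_sub[OF l1 l2] by (simp add: derivation_def)
qed

lemma lie_derivation_sub:
  assumes "lie_derivation A D" "lie_derivation A E" shows "lie_derivation A (\<lambda>x. D x \<ominus> E x)"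
proof -
  note l1 = lie_derivationD(1)[OF assms(1)] and l2 = lie_derivationD(1)[OF assms(2)]
  have "D (commutator A x y) \<ominus> E (commutator A x y)
      = commutator A (D x \<ominus> E x) y \<oplus> commutator A x (D y \<ominus> E y)"
    if "x \<in> carrier A" "y \<in> carrier A" for x y
  proof -
    have c: "x \<in> carrier A" "y \<in> carrier A" "D x \<in> carrier A" "D y \<in> carrier A"
       "E x \<in> carrier A" "E y \<in> carrier A"
      using that linear_mapD(1)[OF l1] linear_mapD(1)[OF l2] by auto
    have "(commutator A (D x) y \<oplus> commutator A x (D y)) \<ominus> (commutator A (E x) y \<oplus> commutator A x (E y))
       = commutator A (D x \<ominus> E x) y \<oplus> commutator A x (D y \<ominus> E y)"
      unfolding commutator_def using c by algebra
    then show ?thesis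
      using lie_derivationD(2)[OF assms(1) that] lie_derivationD(2)[OF assms(2) that] by simp
  qed
  then show ?thesis using linear_map_sub[OF l1 l2] by (simp add: lie_derivation_def)
qed

lemma derivation_inner:
  assumes "a \<in> carrier A" shows "derivation A (commutator A a)"
proof -
  have "linear_map A (commutator A a)"
    unfolding linear_map_def commutator_def
  proof (intro conjI ballI allI funcsetI)
    fix x y assume c: "x \<in> carrier A" "y \<in> carrier A"
    show "a \<otimes> x \<ominus> x \<otimes> a \<in> carrier A" using assms c by simp
    show "a \<otimes> (x \<oplus> y) \<ominus> (x \<oplus> y) \<otimes> a = (a \<otimes> x \<ominus> x \<otimes> a) \<oplus> (a \<otimes> y \<ominus> y \<otimes> a)"
      using assms c by algebra
    show "a \<otimes> (c \<odot> x) \<ominus> (c \<odot> x) \<otimes> a = c \<odot> (a \<otimes> x \<ominus> x \<otimes> a)" for c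
      using assms c by (simp add: smult_mult_left smult_mult_right smult_a_minus)
  qed
  moreover have "commutator A a (x \<otimes> y) = commutator A a x \<otimes> y \<oplus> x \<otimes> commutator A a y"
    if "x \<in> carrier A" "y \<in> carrier A" for x y
    unfolding commutator_def using assms that by algebra
  ultimately show ?thesis by (simp add: derivation_def)
qed

text \<open>Both sides of the Lie identity vanish, because a commutator with a central value is
  zero. This makes the central part of the decomposition subtractable as well.\<close>

lemma central_lie_derivation:
  assumes "linear_map A \<Delta>" "\<Delta> \<in> carrier A \<rightarrow> center A"
    and "\<And>x y. x \<in> carrier A \<Longrightarrow> y \<in> carrier A \<Longrightarrow> \<Delta> (commutator A x y) = \<zero>"
  shows "lie_derivation A \<Delta>"
  unfolding lie_derivation_def
proof (intro conjI ballI assms(1))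
  fix x y assume c: "x \<in> carrier A" "y \<in> carrier A"
  have "\<Delta> x \<in> center A" "\<Delta> y \<in> center A"
    using assms(2) c by auto
  then have "commutator A (\<Delta> x) y = \<zero>" "commutator A x (\<Delta> y) = \<zero>"
    using c by (simp_all add: commutator_def center_def minus_eq_zero_iff)
  then show "\<Delta> (commutator A x y) = commutator A (\<Delta> x) y \<oplus> commutator A x (\<Delta> y)"
    using assms(3) c by simp
qed

end

section \<open>Orthogonal idempotents and the Peirce decomposition\<close>

locale idempotent_kalgebra = kalgebra A for A :: "('k::field, 'x, 'm) module_scheme" (structure) +
  fixes V :: "'v set" and e :: "'v \<Rightarrow> 'x"
  assumes finite_V: "finite V"
    and e_closed [simp, intro]: "i \<in> V \<Longrightarrow> e i \<in> carrier A"
    and e_mult: "i \<in> V \<Longrightarrow> j \<in> V \<Longrightarrow> e i \<otimes> e j = (if i = j then e i else \<zero>)"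
    and finsum_e: "(\<Oplus>i\<in>V. e i) = \<one>"
begin

text \<open>This is the Peirce component \<open>e i A e j\<close>, given as the set of elements
  fixed by both idempotents; membership thus yields rewriting equations at once.\<close>

definition peirce :: "'v \<Rightarrow> 'v \<Rightarrow> 'x set" where
  "peirce i j = {x \<in> carrier A. e i \<otimes> x = x \<and> x \<otimes> e j = x}"

lemma peirceD:
  assumes "x \<in> peirce i j"
  shows "x \<in> carrier A" "e i \<otimes> x = x" "x \<otimes> e j = x"
  using assms by (auto simp: peirce_def)

lemma e_mult_left:
  "i \<in> V \<Longrightarrow> j \<in> V \<Longrightarrow> x \<in> carrier A \<Longrightarrow> e i \<otimes> (e j \<otimes> x) = (if i = j then e i \<otimes> x else \<zero>)"
  using e_mult[of i j] by (metis e_closed l_null m_assoc)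

lemma peirce_e_left:
  assumes "x \<in> peirce i j" "i \<in> V" "k \<in> V"
  shows "e k \<otimes> x = (if k = i then x else \<zero>)"
  using peirceD[OF assms(1)] e_mult_left[OF assms(3,2), of x] by auto

lemma peirce_e_right:
  assumes "x \<in> peirce i j" "j \<in> V" "k \<in> V"
  shows "x \<otimes> e k = (if k = j then x else \<zero>)"
  using peirceD[OF assms(1)] e_mult[OF assms(2,3)] assms(2,3)
  by (metis e_closed m_assoc r_null)

lemma peirce_mult:
  assumes "x \<in> peirce i j" "y \<in> peirce k l" "j \<in> V" "k \<in> V" "i \<in> V" "l \<in> V"
  shows "x \<otimes> y \<in> peirce i l" and "j \<noteq> k \<Longrightarrow> x \<otimes> y = \<zero>"
proof -
  note x = peirceD[OF assms(1)] and y = peirceD[OF assms(2)]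
  show "x \<otimes> y \<in> peirce i l"
    unfolding peirce_def
    using x y m_assoc[of "e i" x y] m_assoc[of x y "e l"] assms(5,6) by simp
  assume "j \<noteq> k"
  have "x \<otimes> y = x \<otimes> (e j \<otimes> y)"
    using m_assoc[of x "e j" y] x y assms(3) by simp
  also have "e j \<otimes> y = \<zero>" using peirce_e_left[OF assms(2,4,3)] \<open>j \<noteq> k\<close> by simp
  finally show "x \<otimes> y = \<zero>" using x by simp
qed

lemma peirce_closed:
  "i \<in> V \<Longrightarrow> j \<in> V \<Longrightarrow> x \<in> peirce i j \<Longrightarrow> y \<in> peirce i j \<Longrightarrow> x \<oplus> y \<in> peirce i j"
  "i \<in> V \<Longrightarrow> j \<in> V \<Longrightarrow> x \<in> peirce i j \<Longrightarrow> y \<in> peirce i j \<Longrightarrow> x \<ominus> y \<in> peirce i j"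
  "i \<in> V \<Longrightarrow> j \<in> V \<Longrightarrow> \<zero> \<in> peirce i j"
  by (simp_all add: peirce_def l_distr r_distr minus_eq l_minus r_minus)

lemma e_peirce: "i \<in> V \<Longrightarrow> e i \<in> peirce i i"
  by (simp add: peirce_def e_mult)

definition pc :: "'v \<Rightarrow> 'x \<Rightarrow> 'v \<Rightarrow> 'x" where
  "pc i x j = e i \<otimes> (x \<otimes> e j)"

lemma pc_peirce [intro]: "i \<in> V \<Longrightarrow> j \<in> V \<Longrightarrow> x \<in> carrier A \<Longrightarrow> pc i x j \<in> peirce i j"
  by (simp add: pc_def peirce_def e_mult_left) (simp add: m_assoc e_mult)

lemma pc_closed [simp, intro]: "i \<in> V \<Longrightarrow> j \<in> V \<Longrightarrow> x \<in> carrier A \<Longrightarrow> pc i x j \<in> carrier A"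
  by (simp add: pc_def)

lemma pc_add:
  "i \<in> V \<Longrightarrow> j \<in> V \<Longrightarrow> x \<in> carrier A \<Longrightarrow> y \<in> carrier A \<Longrightarrow> pc i (x \<oplus> y) j = pc i x j \<oplus> pc i y j"
  by (simp add: pc_def l_distr r_distr)

lemma pc_minus:
  "i \<in> V \<Longrightarrow> j \<in> V \<Longrightarrow> x \<in> carrier A \<Longrightarrow> y \<in> carrier A \<Longrightarrow> pc i (x \<ominus> y) j = pc i x j \<ominus> pc i y j"
  by (simp add: pc_def l_distr r_distr minus_eq l_minus r_minus)

lemma pc_smult:
  "i \<in> V \<Longrightarrow> j \<in> V \<Longrightarrow> x \<in> carrier A \<Longrightarrow> pc i (c \<odot> x) j = c \<odot> pc i x j"
  by (simp add: pc_def smult_mult_left smult_mult_right)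

lemma pc_of_peirce:
  assumes "x \<in> peirce k l" "i \<in> V" "j \<in> V" "k \<in> V" "l \<in> V"
  shows "pc i x j = (if i = k \<and> j = l then x else \<zero>)"
  using peirce_e_left[OF assms(1,4,2)] peirce_e_right[OF assms(1,5,3)] assms
  by (auto simp: pc_def peirceD)

text \<open>As the idempotents sum to \<open>\<one>\<close>, every \<open>z\<close> is the sum of
  its columns \<open>z \<otimes> e j\<close>.\<close>

lemma eq_right:
  assumes "x \<in> carrier A" "y \<in> carrier A" "\<And>j. j \<in> V \<Longrightarrow> x \<otimes> e j = y \<otimes> e j"
  shows "x = y"
proof -
  have "z = (\<Oplus>j\<in>V. z \<otimes> e j)" if "z \<in> carrier A" for z
    using that finsum_rdistr[OF finite_V, of z e] finsum_e by auto
  moreover have "(\<Oplus>j\<in>V. x \<otimes> e j) = (\<Oplus>j\<in>V. y \<otimes> e j)"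
    using assms by (intro finsum_cong') auto
  ultimately show ?thesis using assms(1,2) by metis
qed

lemma eq_left:
  assumes "x \<in> carrier A" "y \<in> carrier A" "\<And>j. j \<in> V \<Longrightarrow> e j \<otimes> x = e j \<otimes> y"
  shows "x = y"
proof -
  have "z = (\<Oplus>j\<in>V. e j \<otimes> z)" if "z \<in> carrier A" for z
    using that finsum_ldistr[OF finite_V, of z e] finsum_e by auto
  moreover have "(\<Oplus>j\<in>V. e j \<otimes> x) = (\<Oplus>j\<in>V. e j \<otimes> y)"
    using assms by (intro finsum_cong') auto
  ultimately show ?thesis using assms(1,2) by metis
qed

lemma pc_eqI:
  assumes "x \<in> carrier A" "y \<in> carrier A" "\<And>i j. i \<in> V \<Longrightarrow> j \<in> V \<Longrightarrow> pc i x j = pc i y j"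
  shows "x = y"
proof (rule eq_right[OF assms(1,2)])
  fix j assume "j \<in> V"
  then show "x \<otimes> e j = y \<otimes> e j"
    using assms by (intro eq_left[of "x \<otimes> e j" "y \<otimes> e j"]) (auto simp: pc_def)
qed

text \<open>On the component \<open>(k, l)\<close> the map \<open>x \<mapsto> [e i, x]\<close> is
  multiplication by \<open>1\<close> if only \<open>i = k\<close>, by \<open>-1\<close> if only
  \<open>i = l\<close>, and by \<open>0\<close> otherwise. Lie identities involving
  \<open>e i\<close> can therefore be tested one component at a time.\<close>

lemma pc_commutator_e:
  assumes "x \<in> carrier A" "i \<in> V" "k \<in> V" "l \<in> V"
  shows "pc k (commutator A x (e i)) l = (if i = l then pc k x l else \<zero>) \<ominus> (if i = k then pc k x l else \<zero>)"
    and "pc k (commutator A (e i) x) l = (if i = k then pc k x l else \<zero>) \<ominus> (if i = l then pc k x l else \<zero>)"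
proof -
  have "pc k (x \<otimes> e i) l = (if i = l then pc k x l else \<zero>)"
    using assms by (simp add: pc_def m_assoc e_mult)
  moreover have "pc k (e i \<otimes> x) l = (if i = k then pc k x l else \<zero>)"
    using assms by (simp add: pc_def m_assoc e_mult_left)
  ultimately show "pc k (commutator A x (e i)) l = (if i = l then pc k x l else \<zero>) \<ominus> (if i = k then pc k x l else \<zero>)"
    and "pc k (commutator A (e i) x) l = (if i = k then pc k x l else \<zero>) \<ominus> (if i = l then pc k x l else \<zero>)"
    using assms by (simp_all add: commutator_def pc_minus)
qed

lemma commutator_e_peirce:
  assumes "x \<in> peirce k l" "i \<in> V" "k \<in> V" "l \<in> V"
  shows "commutator A (e i) x = (if i = k then x else \<zero>) \<ominus> (if i = l then x else \<zero>)"
  using peirce_e_left[OF assms(1,3,2)] peirce_e_right[OF assms(1,4,2)]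
  by (simp add: commutator_def)

text \<open>The idempotents commute, so \<open>[T (e i), e j] + [e i, T (e j)] = 0\<close>. Its
  components tie the off-diagonal entries of the different \<open>T (e i)\<close> together so
  tightly that one element \<open>a\<close> produces all of them as entries of
  \<open>[a, e i]\<close>.\<close>

lemma diagonal_up_to_inner:
  assumes "lie_derivation A T"
  obtains a where "a \<in> carrier A"
    "\<And>i k l. i \<in> V \<Longrightarrow> k \<in> V \<Longrightarrow> l \<in> V \<Longrightarrow> k \<noteq> l \<Longrightarrow> pc k (T (e i) \<ominus> commutator A a (e i)) l = \<zero>"
proof -
  note lin = lie_derivationD(1)[OF assms] and T = lie_derivationD(2)[OF assms]
  have Tc: "T (e i) \<in> carrier A" if "i \<in> V" for i
    using that linear_mapD(1)[OF lin] by simp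
  \<comment> \<open>The element is built column by column: column \<open>l\<close> of
    \<open>a\<close> is column \<open>l\<close> of \<open>T (e l)\<close>.\<close>
  define a where "a = (\<Oplus>l\<in>V. T (e l) \<otimes> e l)"
  have ac: "a \<in> carrier A"
    unfolding a_def using Tc by (intro finsum_closed) auto
  have ae: "a \<otimes> e l = T (e l) \<otimes> e l" if l: "l \<in> V" for l
  proof -
    have "a \<otimes> e l = (\<Oplus>j\<in>V. T (e j) \<otimes> e j \<otimes> e l)"
      unfolding a_def using l Tc by (intro finsum_ldistr finite_V) auto
    also have "\<dots> = (\<Oplus>j\<in>V. if l = j then T (e j) \<otimes> e j else \<zero>)"
      using l Tc by (intro finsum_cong') (auto simp: m_assoc e_mult)
    also have "\<dots> = T (e l) \<otimes> e l"
      using finsum_singleton[OF l finite_V, of "\<lambda>j. T (e j) \<otimes> e j"] Tc by auto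
    finally show ?thesis .
  qed
  have pca: "pc k a l = pc k (T (e l)) l" if "k \<in> V" "l \<in> V" for k l
    using ae that by (simp add: pc_def)
  \<comment> \<open>This is the \<open>(k, l)\<close> component of
    \<open>[T (e i), e i'] + [e i, T (e i')] = 0\<close>, with the second commutator moved to the
    other side.\<close>
  have rel: "(if i = l then pc k (T (e i')) l else \<zero>) \<ominus> (if i = k then pc k (T (e i')) l else \<zero>)
      = (if i' = l then pc k (T (e i)) l else \<zero>) \<ominus> (if i' = k then pc k (T (e i)) l else \<zero>)"
    if V: "i \<in> V" "i' \<in> V" "k \<in> V" "l \<in> V" for i i' k l
  proof -
    have "commutator A (e i) (e i') = \<zero>"
      using V by (simp add: commutator_def e_mult minus_eq_zero_iff)
    then have "commutator A (T (e i)) (e i') \<oplus> commutator A (e i) (T (e i')) = \<zero>"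
      using T[of "e i" "e i'"] V linear_map_zero[OF lin] by simp
    then have "pc k (commutator A (T (e i)) (e i') \<oplus> commutator A (e i) (T (e i'))) l = pc k \<zero> l"
      by simp
    moreover have "pc k \<zero> l = \<zero>"
      using V by (simp add: pc_def)
    ultimately have *: "pc k (commutator A (T (e i)) (e i')) l \<oplus> pc k (commutator A (e i) (T (e i'))) l = \<zero>"
      using V Tc by (simp only: pc_add[OF V(3,4)] commutator_closed Tc e_closed)
    have swap: "q \<ominus> p = z" if "z \<oplus> (p \<ominus> q) = \<zero>" "z \<in> carrier A" "p \<in> carrier A" "q \<in> carrier A" for z p q
    proof -
      have "q \<ominus> p = \<ominus> (p \<ominus> q)" using that by algebra
      then show ?thesis using minus_equality[OF that(1)] that by simp
    qed
    show ?thesis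
      by (rule swap[OF *[unfolded pc_commutator_e[OF Tc[OF V(1)] V(2,3,4)] pc_commutator_e[OF Tc[OF V(2)] V(1,3,4)]]])
         (use V Tc in auto)
  qed
  have "pc k (T (e i) \<ominus> commutator A a (e i)) l = \<zero>"
    if V: "i \<in> V" "k \<in> V" "l \<in> V" and "k \<noteq> l" for i k l
  proof -
    \<comment> \<open>Taking \<open>l\<close> and \<open>i\<close> for the two indices of
      \<open>rel\<close> expresses the entry of \<open>T (e i)\<close> through the entry of
      \<open>T (e l)\<close>, which is the entry of \<open>a\<close>.\<close>
    have "pc k (T (e i)) l = pc k (commutator A a (e i)) l"
      using rel[OF V(3,1,2,3)] pca[OF V(2,3)] V \<open>k \<noteq> l\<close>
      unfolding pc_commutator_e(1)[OF ac V] by (simp add: Tc minus_eq)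
    then show ?thesis using V ac Tc by (simp add: pc_minus minus_eq_zero_iff)
  qed
  with ac show thesis by (rule that)
qed

end

section \<open>Lie derivations with diagonal values on the idempotents\<close>

context idempotent_kalgebra
begin

definition diagonal :: "'x \<Rightarrow> bool" where
  "diagonal t \<longleftrightarrow> t \<in> carrier A \<and> (\<forall>k\<in>V. \<forall>l\<in>V. k \<noteq> l \<longrightarrow> pc k t l = \<zero>)"

text \<open>The commutator with \<open>e m\<close> annihilates diagonal components, and a diagonal
  element has no others.\<close>

lemma diagonal_commute_e:
  assumes "diagonal t" "m \<in> V" shows "e m \<otimes> t = t \<otimes> e m"
proof -
  have t: "t \<in> carrier A" using assms by (simp add: diagonal_def)
  have "commutator A (e m) t = \<zero>"
  proof (rule pc_eqI)
    fix k l assume "k \<in> V" "l \<in> V"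
    then show "pc k (commutator A (e m) t) l = pc k \<zero> l"
      using assms t pc_commutator_e(2)[OF t assms(2), of k l]
      by (cases "k = l") (auto simp: diagonal_def minus_eq_zero_iff pc_def[of _ \<zero>])
  qed (use t assms in auto)
  then show ?thesis using t assms by (simp add: commutator_def minus_eq_zero_iff)
qed

lemma diagonal_mult_peirce:
  assumes "diagonal t" "x \<in> peirce k l" "k \<in> V" "l \<in> V"
  shows "t \<otimes> x \<in> peirce k l" "x \<otimes> t \<in> peirce k l"
proof -
  have t: "t \<in> carrier A" using assms by (simp add: diagonal_def)
  note x = peirceD[OF assms(2)]
  have "e k \<otimes> (t \<otimes> x) = t \<otimes> (e k \<otimes> x)"
    using diagonal_commute_e[OF assms(1,3)] t x(1) assms(3) by (metis e_closed m_assoc)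
  moreover have "(x \<otimes> t) \<otimes> e l = (x \<otimes> e l) \<otimes> t"
    using diagonal_commute_e[OF assms(1,4)] t x(1) assms(4) by (metis e_closed m_assoc)
  moreover have "(t \<otimes> x) \<otimes> e l = t \<otimes> (x \<otimes> e l)" "e k \<otimes> (x \<otimes> t) = (e k \<otimes> x) \<otimes> t"
    using t x(1) assms(3,4) by (simp_all add: m_assoc)
  ultimately show "t \<otimes> x \<in> peirce k l" "x \<otimes> t \<in> peirce k l"
    using t x unfolding peirce_def by simp_all
qed

text \<open>Since \<open>[e i, x]\<close> is a multiple of \<open>x\<close> by \<open>1\<close>,
  \<open>-1\<close> or \<open>0\<close>, applying \<open>T\<close> compares the same multiple of
  \<open>T x\<close> with \<open>[T (e i), x] + [e i, T x]\<close>. Outside the component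
  \<open>(k, l)\<close> the first commutator does not contribute, and suitable choices of
  \<open>i\<close> force the entries of \<open>T x\<close> to vanish. Inside it, the two multiples
  of \<open>T x\<close> cancel and leave \<open>[T (e i), x] = 0\<close>.\<close>

lemma off_diagonal_peirce:
  assumes two: "(2::'k) \<noteq> 0" and "lie_derivation A T"
    and diag: "\<And>i. i \<in> V \<Longrightarrow> diagonal (T (e i))"
    and x: "x \<in> peirce k l" and kl: "k \<in> V" "l \<in> V" "k \<noteq> l"
  shows "T x \<in> peirce k l" and "i \<in> V \<Longrightarrow> commutator A (T (e i)) x = \<zero>"
proof -
  note lin = lie_derivationD(1)[OF assms(2)] and T = lie_derivationD(2)[OF assms(2)]
  have Tc: "T (e i) \<in> carrier A" if "i \<in> V" for i
    using that linear_mapD(1)[OF lin] by simp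
  note xc = peirceD(1)[OF x]
  define t where "t = T x"
  have tc: "t \<in> carrier A" using linear_mapD(1)[OF lin xc] by (simp add: t_def)
  \<comment> \<open>The operation \<open>c i\<close> is the multiplication by \<open>1\<close>,
    \<open>-1\<close> or \<open>0\<close> that \<open>[e i, _]\<close> performs on the component
    \<open>(k, l)\<close>.\<close>
  define c where "c i y = (if i = k then y else \<zero>) \<ominus> (if i = l then y else \<zero>)" for i y
  have Tcx: "T (c i x) = c i t" if "i \<in> V" for i
    using xc by (simp add: c_def t_def linear_map_diff[OF lin] linear_map_zero[OF lin])
  define z where "z i = commutator A (T (e i)) x" for i
  \<comment> \<open>A diagonal element multiplies each Peirce component into itself, so
    \<open>z i\<close> lives in \<open>(k, l)\<close> alone.\<close>
  have zp: "z i \<in> peirce k l" if "i \<in> V" for i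
    unfolding z_def commutator_def
    using diagonal_mult_peirce[OF diag[OF that] x] kl by (intro peirce_closed) auto
  have main: "c i t = z i \<oplus> commutator A (e i) t" if "i \<in> V" for i
    using T[of "e i" x] commutator_e_peirce[OF x that kl(1,2)] Tcx[OF that] that xc
    by (simp add: c_def z_def t_def)
  have zero: "pc m t n = \<zero>" if mn: "m \<in> V" "n \<in> V" "\<not> (m = k \<and> n = l)" for m n
  proof -
    have tmn: "pc m t n \<in> carrier A" using mn tc by simp
    have pcz: "pc m (z i) n = \<zero>" if "i \<in> V" for i
      using pc_of_peirce[OF zp[OF that] mn(1,2) kl(1,2)] mn(3) by auto
    have comp: "pc m (c i t) n = pc m (commutator A (e i) t) n" if "i \<in> V" for i
      using main[OF that] pcz[OF that] that mn tc peirceD(1)[OF zp[OF that]] by (simp add: pc_add)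
    show ?thesis
    proof (cases "m = k")
      case False
      \<comment> \<open>For \<open>m \<noteq> k\<close> the test element is \<open>e k\<close>: the
        left side is the full entry of \<open>t\<close>, while the right side is its negative if
        \<open>n = k\<close> and zero otherwise. The subcase \<open>n = k\<close> is the one that
        needs \<open>2 \<noteq> 0\<close>.\<close>
      have "c k t = t" using tc kl(3) by (simp add: c_def minus_eq)
      then have eq: "pc m t n = \<zero> \<ominus> (if k = n then pc m t n else \<zero>)"
        using comp[OF kl(1)] pc_commutator_e(2)[OF tc kl(1) mn(1,2)] False by metis
      show ?thesis
      proof (cases "k = n")
        case True
        have "pc m t n = \<zero> \<ominus> pc m t n" using eq unfolding if_P[OF True] .
        then show ?thesis using eq_minus_imp_zero[OF two tmn] tmn by (metis minus_eq l_zero a_inv_closed)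
      next
        case False
        then show ?thesis using eq unfolding if_not_P[OF False] by (simp add: minus_eq)
      qed
    next
      case True
      \<comment> \<open>For \<open>m = k\<close>, hence \<open>n \<noteq> l\<close>, the test
        element is \<open>e l\<close>: it meets neither index of the entry, so the right side
        vanishes, whereas \<open>c l\<close> negates \<open>t\<close>.\<close>
      then have "pc m (\<zero> \<ominus> t) n = \<zero>"
        using comp[OF kl(2)] kl tmn tc mn by (simp add: c_def pc_commutator_e minus_eq)
      then have "\<ominus> pc m t n = \<zero>"
        using mn tc pc_minus[OF mn(1,2) zero_closed tc] by (simp add: pc_def[of _ \<zero>] minus_eq)
      then show ?thesis using tmn by (metis minus_minus minus_zero)
    qed
  qed
  have "t = pc k t l"
  proof (rule pc_eqI)
    fix m n assume "m \<in> V" "n \<in> V"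
    then show "pc m t n = pc m (pc k t l) n"
      using zero[of m n] pc_of_peirce[OF pc_peirce[OF kl(1,2) tc], of m n] kl by auto
  qed (use tc kl in auto)
  then have tp: "t \<in> peirce k l" using pc_peirce[OF kl(1,2) tc] by metis
  then show "T x \<in> peirce k l" by (simp add: t_def)
  assume i: "i \<in> V"
  \<comment> \<open>Now that \<open>t\<close> is known to lie in \<open>(k, l)\<close>, its
    commutator with \<open>e i\<close> is again \<open>c i t\<close>, and cancellation leaves
    \<open>z i = \<zero>\<close>.\<close>
  have "c i t = z i \<oplus> c i t"
    using main[OF i] commutator_e_peirce[OF tp i kl(1,2)] by (simp add: c_def)
  moreover have "c i t \<in> carrier A" "z i \<in> carrier A"
    using tc peirceD(1)[OF zp[OF i]] by (simp_all add: c_def)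
  ultimately have "z i = \<zero>"
    using add.r_cancel_one'[of "c i t" "z i"] by blast
  then show "commutator A (T (e i)) x = \<zero>" by (simp add: z_def)
qed

end

section \<open>Characters dual to the idempotents, and loops\<close>

locale character_kalgebra = idempotent_kalgebra A V e
  for A :: "('k::field, 'x, 'm) module_scheme" (structure) and V :: "'v set" and e +
  fixes \<chi> :: "'v \<Rightarrow> 'x \<Rightarrow> 'k"
  assumes \<chi>_add: "i \<in> V \<Longrightarrow> x \<in> carrier A \<Longrightarrow> y \<in> carrier A \<Longrightarrow> \<chi> i (x \<oplus> y) = \<chi> i x + \<chi> i y"
    and \<chi>_smult: "i \<in> V \<Longrightarrow> x \<in> carrier A \<Longrightarrow> \<chi> i (c \<odot> x) = c * \<chi> i x"
    and \<chi>_mult: "i \<in> V \<Longrightarrow> x \<in> carrier A \<Longrightarrow> y \<in> carrier A \<Longrightarrow> \<chi> i (x \<otimes> y) = \<chi> i x * \<chi> i y"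
    and \<chi>_e: "i \<in> V \<Longrightarrow> j \<in> V \<Longrightarrow> \<chi> i (e j) = (if i = j then 1 else 0)"
begin

lemma \<chi>_zero: "i \<in> V \<Longrightarrow> \<chi> i \<zero> = 0"
  using \<chi>_smult[of i \<zero> 0] by simp

lemma \<chi>_minus: "i \<in> V \<Longrightarrow> x \<in> carrier A \<Longrightarrow> y \<in> carrier A \<Longrightarrow> \<chi> i (x \<ominus> y) = \<chi> i x - \<chi> i y"
  using \<chi>_add[of i "x \<ominus> y" y] by (simp add: minus_eq a_assoc l_neg)

lemma \<chi>_commutator:
  "i \<in> V \<Longrightarrow> x \<in> carrier A \<Longrightarrow> y \<in> carrier A \<Longrightarrow> \<chi> i (commutator A x y) = 0"
  by (simp add: commutator_def \<chi>_minus \<chi>_mult)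

text \<open>From \<open>x = e k x e l\<close>, the value carries the factors
  \<open>\<chi> i (e k)\<close> and \<open>\<chi> i (e l)\<close>; one of them is zero because
  \<open>i\<close> cannot equal both \<open>k\<close> and \<open>l\<close>.\<close>

lemma \<chi>_off_diagonal:
  assumes "x \<in> peirce k l" "k \<in> V" "l \<in> V" "k \<noteq> l" "i \<in> V" shows "\<chi> i x = 0"
proof -
  have "\<chi> i x = \<chi> i (e k) * \<chi> i x" "\<chi> i x = \<chi> i x * \<chi> i (e l)"
    using \<chi>_mult[of i "e k" x] \<chi>_mult[of i x "e l"] peirceD[OF assms(1)] assms by auto
  then show ?thesis using \<chi>_e assms by (metis mult_zero_left mult_zero_right)
qed

text \<open>
  Abstracts the products \<open>q\<^sup>*p\<close> of nontrivial paths \<open>p, q : i \<rightarrow> m\<close>. The conditions on \<open>p\<close> and \<open>q\<close>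
  are what remains of \<open>\<alpha>\<beta>\<^sup>* = 0\<close> together with acyclicity.
\<close>

definition loops :: "'v \<Rightarrow> 'x set" where
  "loops i = {q \<otimes> p | q p m. m \<in> V \<and> m \<noteq> i \<and> q \<in> peirce i m \<and> p \<in> peirce m i \<and>
     (\<forall>x\<in>peirce i m. p \<otimes> x = \<zero>) \<and> (\<forall>x\<in>peirce m i. x \<otimes> q = \<zero>) \<and>
     (\<forall>x\<in>peirce i i. x \<otimes> q = \<chi> i x \<odot> q \<and> p \<otimes> x = \<chi> i x \<odot> p)}"

lemma loopsE:
  assumes "b \<in> loops i"
  obtains q p m where "b = q \<otimes> p" "m \<in> V" "m \<noteq> i" "q \<in> peirce i m" "p \<in> peirce m i"
    "\<And>x. x \<in> peirce i m \<Longrightarrow> p \<otimes> x = \<zero>" "\<And>x. x \<in> peirce m i \<Longrightarrow> x \<otimes> q = \<zero>"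
    "\<And>x. x \<in> peirce i i \<Longrightarrow> x \<otimes> q = \<chi> i x \<odot> q" "\<And>x. x \<in> peirce i i \<Longrightarrow> p \<otimes> x = \<chi> i x \<odot> p"
  using assms unfolding loops_def by blast

lemma loops_peirce: "b \<in> loops i \<Longrightarrow> i \<in> V \<Longrightarrow> b \<in> peirce i i"
  by (erule loopsE) (simp add: peirce_mult(1))

text \<open>A loop is a product of off-diagonal elements, on which the multiplicative map
  \<open>\<chi> j\<close> vanishes.\<close>

lemma \<chi>_loop:
  assumes "b \<in> loops i" "i \<in> V" "j \<in> V" shows "\<chi> j b = 0"
  using assms by (elim loopsE) (auto simp: \<chi>_mult peirceD \<chi>_off_diagonal)

text \<open>The factors \<open>q\<close> and \<open>p\<close> of a loop see elements of
  \<open>peirce i i\<close> only through \<open>\<chi> i\<close>, and associativity passes this on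
  to \<open>q \<otimes> p\<close>. Together with \<open>\<chi>_loop\<close> it makes the product of
  two loops at the same vertex zero.\<close>

lemma mult_loop:
  assumes b: "b \<in> loops i" and "i \<in> V" and x: "x \<in> peirce i i"
  shows "x \<otimes> b = \<chi> i x \<odot> b" "b \<otimes> x = \<chi> i x \<odot> b"
proof -
  have "x \<otimes> b = \<chi> i x \<odot> b \<and> b \<otimes> x = \<chi> i x \<odot> b"
  proof (rule loopsE[OF b])
    fix q p m assume *: "b = q \<otimes> p" "q \<in> peirce i m" "p \<in> peirce m i"
      "\<And>x. x \<in> peirce i i \<Longrightarrow> x \<otimes> q = \<chi> i x \<odot> q" "\<And>x. x \<in> peirce i i \<Longrightarrow> p \<otimes> x = \<chi> i x \<odot> p"
    note c = peirceD(1)[OF x] peirceD(1)[OF *(2)] peirceD(1)[OF *(3)]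
    have "x \<otimes> (q \<otimes> p) = (x \<otimes> q) \<otimes> p" using c by (simp add: m_assoc)
    then show ?thesis using c *(4,5)[OF x] *(1) by (simp add: m_assoc smult_mult_right smult_mult_left)
  qed
  then show "x \<otimes> b = \<chi> i x \<odot> b" "b \<otimes> x = \<chi> i x \<odot> b" by simp_all
qed

end

text \<open>The set \<open>B\<close> abstracts the nonzero classes of paths: trivial paths, paths
  with distinct ends, and nontrivial closed paths. That \<open>B\<close> spans the algebra is
  expressed as an induction principle, which spares explicit linear combinations.\<close>

locale folded_kalgebra = character_kalgebra A V e \<chi>
  for A :: "('k::field, 'x, 'm) module_scheme" (structure) and V :: "'v set" and e \<chi> +
  fixes B :: "'x set"
  assumes B_closed: "B \<subseteq> carrier A"
    and B_cases: "b \<in> B \<Longrightarrow> (\<exists>i\<in>V. b = e i) \<or> (\<exists>i\<in>V. \<exists>j\<in>V. i \<noteq> j \<and> b \<in> peirce i j) \<or> (\<exists>i\<in>V. b \<in> loops i)"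
    and span_induct [consumes 1, case_names zero basis add smult]: "x \<in> carrier A \<Longrightarrow> P \<zero> \<Longrightarrow> (\<And>b. b \<in> B \<Longrightarrow> P b) \<Longrightarrow>
      (\<And>x y. x \<in> carrier A \<Longrightarrow> y \<in> carrier A \<Longrightarrow> P x \<Longrightarrow> P y \<Longrightarrow> P (x \<oplus> y)) \<Longrightarrow>
      (\<And>c x. x \<in> carrier A \<Longrightarrow> P x \<Longrightarrow> P (c \<odot> x)) \<Longrightarrow> P x"
begin

text \<open>A loop factors into off-diagonal elements, so commuting with these and with the
  idempotents means commuting with a spanning set.\<close>

lemma commutes_all:
  assumes "z \<in> carrier A" "\<And>i. i \<in> V \<Longrightarrow> z \<otimes> e i = e i \<otimes> z"
    and off: "\<And>i j x. i \<in> V \<Longrightarrow> j \<in> V \<Longrightarrow> i \<noteq> j \<Longrightarrow> x \<in> peirce i j \<Longrightarrow> z \<otimes> x = x \<otimes> z"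
  shows "z \<in> center A"
proof -
  have "z \<otimes> x = x \<otimes> z" if "x \<in> carrier A" for x
    using that
  proof (induction rule: span_induct)
    case (basis b)
    show ?case
    proof -
      have "z \<otimes> b = b \<otimes> z" if i: "i \<in> V" and "b \<in> loops i" for i
      proof (rule loopsE[OF that(2)])
        fix q p m assume *: "b = q \<otimes> p" "m \<in> V" "m \<noteq> i" "q \<in> peirce i m" "p \<in> peirce m i"
        have "q \<in> carrier A" "p \<in> carrier A" "z \<otimes> q = q \<otimes> z" "z \<otimes> p = p \<otimes> z"
          using * i off peirceD(1) by auto
        then show ?thesis using assms(1) *(1) by (metis m_assoc)
      qed
      then show ?thesis using B_cases[OF basis] assms(2) off by blast
    qed
  next
    case (add x y) then show ?case using assms(1) by (simp add: l_distr r_distr)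
  next
    case (smult c x) then show ?case using assms(1) by (simp add: smult_mult_left smult_mult_right)
  qed (use assms(1) in simp)
  then show ?thesis using assms(1) by (simp add: center_def)
qed

section \<open>A normalised Lie derivation is a derivation\<close>

context
  fixes D
  assumes lie: "lie_derivation A D"
    and De: "\<And>i. i \<in> V \<Longrightarrow> D (e i) = \<zero>"
    and off: "\<And>i j x. i \<in> V \<Longrightarrow> j \<in> V \<Longrightarrow> i \<noteq> j \<Longrightarrow> x \<in> peirce i j \<Longrightarrow> D x \<in> peirce i j"
begin

lemmas lin = lie_derivationD(1)[OF lie]
lemmas D_closed = linear_mapD(1)[OF lin]

text \<open>Since \<open>p \<otimes> q = \<zero>\<close>, a loop is the commutator
  \<open>[q, p]\<close>, and the Lie identity computes \<open>D b\<close> as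
  \<open>D q \<otimes> p \<oplus> q \<otimes> D p\<close>. Both summands are products of
  off-diagonal elements, hence invisible to \<open>\<chi> i\<close>.\<close>

lemma D_loop:
  assumes i: "i \<in> V" and "b \<in> loops i"
  shows "D b \<in> peirce i i" "\<chi> i (D b) = 0"
proof -
  have "D b \<in> peirce i i \<and> \<chi> i (D b) = 0"
  proof (rule loopsE[OF assms(2)])
    fix q p m
    assume *: "b = q \<otimes> p" "m \<in> V" "m \<noteq> i" "q \<in> peirce i m" "p \<in> peirce m i"
      "\<And>x. x \<in> peirce i m \<Longrightarrow> p \<otimes> x = \<zero>" "\<And>x. x \<in> peirce m i \<Longrightarrow> x \<otimes> q = \<zero>"
    have Dq: "D q \<in> peirce i m" and Dp: "D p \<in> peirce m i"
      using off * i by auto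
    note c = peirceD(1)[OF *(4)] peirceD(1)[OF *(5)] peirceD(1)[OF Dq] peirceD(1)[OF Dp]
    have "b = commutator A q p"
      using c *(1) *(6)[OF *(4)] by (simp add: commutator_def minus_eq)
    then have "D b = commutator A (D q) p \<oplus> commutator A q (D p)"
      using lie_derivationD(2)[OF lie, of q p] c by simp
    \<comment> \<open>The reversed products \<open>p \<otimes> D q\<close> and
      \<open>D p \<otimes> q\<close> vanish because a loop requires \<open>p\<close> and
      \<open>q\<close> to annihilate the whole opposite Peirce component.\<close>
    also have "\<dots> = D q \<otimes> p \<oplus> q \<otimes> D p"
      using c *(6)[OF Dq] *(7)[OF Dp] by (simp add: commutator_def minus_eq)
    finally have Db: "D b = D q \<otimes> p \<oplus> q \<otimes> D p" .
    have "D q \<otimes> p \<in> peirce i i" "q \<otimes> D p \<in> peirce i i"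
      using peirce_mult(1)[OF Dq *(5)] peirce_mult(1)[OF *(4) Dp] *(2) i by auto
    moreover have "\<chi> i (D q \<otimes> p) = 0" "\<chi> i (q \<otimes> D p) = 0"
      using c i \<chi>_off_diagonal[OF *(4)] \<chi>_off_diagonal[OF *(5)] * by (simp_all add: \<chi>_mult)
    ultimately show ?thesis
      unfolding Db using i c by (simp add: peirce_closed \<chi>_add)
  qed
  then show "D b \<in> peirce i i" "\<chi> i (D b) = 0" by auto
qed

lemma D_homogeneous:
  assumes "b \<in> B" obtains i j where "i \<in> V" "j \<in> V" "b \<in> peirce i j" "D b \<in> peirce i j"
  using B_cases[OF assms] e_peirce De peirce_closed(3) off loops_peirce D_loop(1) by metis

text \<open>On a spanning element \<open>b\<close> with \<open>b\<close> and \<open>D b\<close> in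
  the same component, a Peirce projection keeps both or kills both.\<close>

lemma D_pc:
  assumes ij: "i \<in> V" "j \<in> V" and "x \<in> carrier A" shows "D (pc i x j) = pc i (D x) j"
  using assms(3)
proof (induction rule: span_induct)
  case zero
  have "pc i \<zero> j = \<zero>" using ij by (simp add: pc_def)
  then show ?case by (simp add: linear_map_zero[OF lin])
next
  case (basis b)
  then obtain k l where "k \<in> V" "l \<in> V" "b \<in> peirce k l" "D b \<in> peirce k l"
    by (rule D_homogeneous)
  then show ?case
    using ij by (simp add: pc_of_peirce linear_map_zero[OF lin])
next
  case (add x y) then show ?case using ij by (simp add: pc_add linear_mapD[OF lin])
next
  case (smult c x) then show ?case using ij by (simp add: pc_smult linear_mapD[OF lin])
qed

text \<open>The product \<open>a \<otimes> b\<close> can be recovered from \<open>[a, b]\<close> by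
  projecting to the component \<open>(i, l)\<close>: for \<open>j = k\<close>, the reversed product
  meets that component only if all four indices agree, which is excluded. As \<open>D\<close>
  commutes with projections, the Lie identity becomes the Leibniz rule.\<close>

lemma D_mult_homogeneous:
  assumes V: "i \<in> V" "j \<in> V" "k \<in> V" "l \<in> V"
    and a: "a \<in> peirce i j" "D a \<in> peirce i j" and b: "b \<in> peirce k l" "D b \<in> peirce k l"
    and noloop: "\<not> (i = j \<and> k = l)"
  shows "D (a \<otimes> b) = D a \<otimes> b \<oplus> a \<otimes> D b"
proof (cases "j = k")
  case False
  then show ?thesis
    using peirce_mult(2)[OF a(1) b(1)] peirce_mult(2)[OF a(2) b(1)] peirce_mult(2)[OF a(1) b(2)] V
    by (simp add: linear_map_zero[OF lin])
next
  case True
  note c = peirceD(1)[OF a(1)] peirceD(1)[OF a(2)] peirceD(1)[OF b(1)] peirceD(1)[OF b(2)]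
  have vanish: "pc i (u \<otimes> v) l = \<zero>" if "u \<in> peirce k l" "v \<in> peirce i j" for u v
  proof (cases "l = i")
    case False
    then show ?thesis using peirce_mult(2)[OF that] V by (simp add: pc_def)
  next
    case eq: True
    then show ?thesis
      using pc_of_peirce[OF peirce_mult(1)[OF that]] V eq \<open>j = k\<close> noloop by auto
  qed
  have fwd: "pc i (u \<otimes> v) l = u \<otimes> v" if "u \<in> peirce i j" "v \<in> peirce k l" for u v
    using pc_of_peirce[OF peirce_mult(1)[OF that]] V by simp
  have "D (a \<otimes> b) = D (pc i (commutator A a b) l)"
    using c V fwd[OF a(1) b(1)] vanish[OF b(1) a(1)]
    by (simp add: commutator_def pc_minus) (simp add: minus_eq)
  also have "\<dots> = pc i (D (commutator A a b)) l"
    using c V by (simp add: D_pc)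
  also have "\<dots> = pc i (commutator A (D a) b \<oplus> commutator A a (D b)) l"
    using lie_derivationD(2)[OF lie] c by simp
  also have "\<dots> = D a \<otimes> b \<oplus> a \<otimes> D b"
    using c V fwd[OF a(2) b(1)] vanish[OF b(1) a(2)] fwd[OF a(1) b(2)] vanish[OF b(2) a(1)]
    by (simp add: commutator_def pc_minus pc_add) (simp add: minus_eq)
  finally show ?thesis .
qed

lemma D_mult_basis:
  assumes "a \<in> B" "b \<in> B" shows "D (a \<otimes> b) = D a \<otimes> b \<oplus> a \<otimes> D b"
proof -
  obtain i j where a: "i \<in> V" "j \<in> V" "a \<in> peirce i j" "D a \<in> peirce i j"
    using assms(1) by (rule D_homogeneous)
  obtain k l where b: "k \<in> V" "l \<in> V" "b \<in> peirce k l" "D b \<in> peirce k l"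
    using assms(2) by (rule D_homogeneous)
  note c = peirceD(1)[OF a(3)] peirceD(1)[OF a(4)] peirceD(1)[OF b(3)] peirceD(1)[OF b(4)]
  have e_left: ?thesis if "a = e i'" "i' \<in> V" for i'
    using that c peirce_e_left[OF b(3)] peirce_e_left[OF b(4)] b(1)
    by (simp add: De linear_map_zero[OF lin])
  have e_right: ?thesis if "b = e i'" "i' \<in> V" for i'
    using that c peirce_e_right[OF a(3)] peirce_e_right[OF a(4)] a(2)
    by (simp add: De linear_map_zero[OF lin])
  have off_left: ?thesis if "i' \<in> V" "j' \<in> V" "i' \<noteq> j'" "a \<in> peirce i' j'" for i' j'
    using D_mult_homogeneous[OF that(1,2) b(1,2) that(4) off[OF that] b(3,4)] that by blast
  have off_right: ?thesis if "i' \<in> V" "j' \<in> V" "i' \<noteq> j'" "b \<in> peirce i' j'" for i' j'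
    using D_mult_homogeneous[OF a(1,2) that(1,2) a(3,4) that(4) off[OF that]] that by blast
  \<comment> \<open>Two loops are the case that commutators cannot reach. At the same vertex all
    three products are zero, since \<open>\<chi>\<close> vanishes on loops and on their images under
    \<open>D\<close>; at different vertices nothing composes.\<close>
  have loop: ?thesis if ab: "i' \<in> V" "a \<in> loops i'" "k' \<in> V" "b \<in> loops k'" for i' k'
  proof (cases "i' = k'")
    case True
    have "a \<otimes> b = \<zero>" "D a \<otimes> b = \<zero>" "a \<otimes> D b = \<zero>"
      using mult_loop(1)[OF ab(4,3)] mult_loop(2)[OF ab(2,1)] loops_peirce[OF ab(2,1)]
        D_loop[OF ab(1,2)] D_loop[OF ab(3,4)] \<chi>_loop[OF ab(2,1)] ab(1) c True
      by (simp_all add: smult_zero_left)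
    then show ?thesis by (simp add: linear_map_zero[OF lin])
  next
    case False
    have "a \<in> peirce i' i'" "b \<in> peirce k' k'" "D a \<in> peirce i' i'" "D b \<in> peirce k' k'"
      using loops_peirce D_loop ab by auto
    then show ?thesis
      using False ab peirce_mult(2)[of _ i' i' _ k' k'] by (simp add: linear_map_zero[OF lin])
  qed
  show ?thesis
    using B_cases[OF assms(1)] B_cases[OF assms(2)] e_left e_right off_left off_right loop by blast
qed

text \<open>Both sides of the Leibniz rule are bilinear, so it spreads from pairs of spanning
  elements, first in the left argument and then in the right one.\<close>

lemma normalised_lie_derivation: "derivation A D"
  unfolding derivation_def
proof (intro conjI ballI lin)
  fix x y assume xy: "x \<in> carrier A" "y \<in> carrier A"
  have left: "D (x \<otimes> b) = D x \<otimes> b \<oplus> x \<otimes> D b" if b: "b \<in> B" for b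
    using xy(1)
  proof (induction rule: span_induct)
    case zero
    show ?case using b B_closed D_closed by (auto simp: linear_map_zero[OF lin])
  next
    case (basis a) then show ?case by (rule D_mult_basis[OF _ b])
  next
    case (add u v)
    have "b \<in> carrier A" using b B_closed by auto
    then show ?case using add D_closed by (simp add: l_distr linear_mapD[OF lin] a_ac)
  next
    case (smult c u)
    have "b \<in> carrier A" using b B_closed by auto
    then show ?case using smult D_closed
      by (simp add: smult_mult_left linear_mapD[OF lin] smult_r_distr)
  qed
  show "D (x \<otimes> y) = D x \<otimes> y \<oplus> x \<otimes> D y"
    using xy(2)
  proof (induction rule: span_induct)
    case zero
    show ?case using xy D_closed by (simp add: linear_map_zero[OF lin])
  next
    case (basis b) then show ?case by (rule left)
  next
    case (add u v) then show ?case using xy D_closed by (simp add: r_distr linear_mapD[OF lin] a_ac)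
  next
    case (smult c u) then show ?case using xy D_closed
      by (simp add: smult_mult_right linear_mapD[OF lin] smult_r_distr)
  qed
qed

end

section \<open>Existence and uniqueness of the standard form\<close>

lemma center_finsum:
  assumes "f \<in> V \<rightarrow> center A" shows "(\<Oplus>i\<in>V. f i) \<in> center A"
proof -
  have "f \<in> V \<rightarrow> carrier A" using assms by (auto simp: center_def)
  moreover have "(\<Oplus>i\<in>V. f i \<otimes> a) = (\<Oplus>i\<in>V. a \<otimes> f i)" if "a \<in> carrier A" for a
    using assms that by (intro finsum_cong') (auto simp: center_def)
  ultimately show ?thesis
    by (auto simp: center_def finsum_ldistr[OF finite_V] finsum_rdistr[OF finite_V])
qed

theorem lie_derivation_standard:
  assumes two: "(2::'k) \<noteq> 0" and "lie_derivation A T"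
  shows "\<exists>D \<Delta>. standard_decomposition A T D \<Delta>"
proof -
  obtain a where a: "a \<in> carrier A"
    and diag: "\<And>i k l. i \<in> V \<Longrightarrow> k \<in> V \<Longrightarrow> l \<in> V \<Longrightarrow> k \<noteq> l \<Longrightarrow> pc k (T (e i) \<ominus> commutator A a (e i)) l = \<zero>"
    using diagonal_up_to_inner[OF assms(2)] by metis
  define S where "S x = T x \<ominus> commutator A a x" for x
  have S: "lie_derivation A S"
    unfolding S_def using assms(2) derivation_imp_lie[OF derivation_inner[OF a]]
    by (rule lie_derivation_sub)
  note S_lin = lie_derivationD(1)[OF S]
  have Se_closed: "S (e i) \<in> carrier A" if "i \<in> V" for i
    using that linear_mapD(1)[OF S_lin] by simp
  have Se: "diagonal (S (e i))" if "i \<in> V" for i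
    using diag that Se_closed by (simp add: diagonal_def S_def)
  have central: "S (e i) \<in> center A" if i: "i \<in> V" for i
  proof (rule commutes_all)
    fix k l x assume "k \<in> V" "l \<in> V" "k \<noteq> l" "x \<in> peirce k l"
    then show "S (e i) \<otimes> x = x \<otimes> S (e i)"
      using off_diagonal_peirce(2)[OF two S Se _ _ _ _ i, of x k l] Se_closed[OF i] peirceD(1)
      by (simp add: commutator_def minus_eq_zero_iff)
  qed (use Se_closed diagonal_commute_e[OF Se[OF i]] i in auto)
  \<comment> \<open>The characters are dual to the idempotents, so this map agrees with
    \<open>S\<close> on every \<open>e i\<close>. It inherits from the characters that it kills
    commutators and off-diagonal elements, so subtracting it normalises \<open>S\<close> without
    changing \<open>S\<close> off the diagonal.\<close>
  define \<Delta> where "\<Delta> x = (\<Oplus>i\<in>V. \<chi> i x \<odot> S (e i))" for x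
  have \<Delta>_center: "\<Delta> x \<in> center A" if "x \<in> carrier A" for x
    unfolding \<Delta>_def using central
    by (intro center_finsum) (auto simp: center_def smult_mult_left smult_mult_right)
  have "linear_map A \<Delta>"
    unfolding linear_map_def
  proof (intro conjI ballI allI funcsetI)
    fix x y c assume x: "x \<in> carrier A"
    then show "\<Delta> x \<in> carrier A" using \<Delta>_center by (auto simp: center_def)
    have "\<Delta> (c \<odot> x) = (\<Oplus>i\<in>V. c \<odot> (\<chi> i x \<odot> S (e i)))"
      unfolding \<Delta>_def using x Se_closed by (intro finsum_cong') (auto simp: \<chi>_smult smult_assoc)
    also have "\<dots> = c \<odot> \<Delta> x"
      unfolding \<Delta>_def using Se_closed by (intro smult_finsum[OF finite_V, symmetric]) auto
    finally show "\<Delta> (c \<odot> x) = c \<odot> \<Delta> x" .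
    assume y: "y \<in> carrier A"
    have "\<Delta> (x \<oplus> y) = (\<Oplus>i\<in>V. \<chi> i x \<odot> S (e i) \<oplus> \<chi> i y \<odot> S (e i))"
      unfolding \<Delta>_def using x y Se_closed by (intro finsum_cong') (auto simp: \<chi>_add smult_l_distr)
    also have "\<dots> = \<Delta> x \<oplus> \<Delta> y"
      unfolding \<Delta>_def using Se_closed by (intro finsum_addf) auto
    finally show "\<Delta> (x \<oplus> y) = \<Delta> x \<oplus> \<Delta> y" .
  qed
  have \<Delta>_vanish: "\<Delta> x = \<zero>" if "\<And>i. i \<in> V \<Longrightarrow> \<chi> i x = 0" for x
  proof -
    have "\<Delta> x = (\<Oplus>i\<in>V. \<zero>)"
      unfolding \<Delta>_def using that Se_closed by (intro finsum_cong') (auto simp: smult_zero_left)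
    then show ?thesis by simp
  qed
  have \<Delta>_commutator: "\<Delta> (commutator A x y) = \<zero>" if "x \<in> carrier A" "y \<in> carrier A" for x y
    using that by (intro \<Delta>_vanish \<chi>_commutator)
  have \<Delta>_e: "\<Delta> (e j) = S (e j)" if j: "j \<in> V" for j
  proof -
    have "\<Delta> (e j) = (\<Oplus>i\<in>V. if j = i then S (e i) else \<zero>)"
      unfolding \<Delta>_def using j Se_closed
      by (intro finsum_cong') (auto simp: \<chi>_e smult_one smult_zero_left)
    then show ?thesis
      using finsum_singleton[OF j finite_V, of "\<lambda>i. S (e i)"] Se_closed by auto
  qed
  have \<Delta>_fun: "\<Delta> \<in> carrier A \<rightarrow> center A" using \<Delta>_center by auto
  have \<Delta>_closed: "\<Delta> x \<in> carrier A" if "x \<in> carrier A" for x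
    using \<Delta>_center[OF that] by (simp add: center_def)
  define D where "D x = S x \<ominus> \<Delta> x" for x
  have "lie_derivation A D"
    unfolding D_def using S central_lie_derivation[OF \<open>linear_map A \<Delta>\<close> \<Delta>_fun \<Delta>_commutator]
    by (rule lie_derivation_sub)
  then have "derivation A D"
  proof (rule normalised_lie_derivation)
    fix i assume "i \<in> V"
    then show "D (e i) = \<zero>" by (simp add: D_def \<Delta>_e Se_closed minus_eq_zero_iff)
  next
    fix i j x assume *: "i \<in> V" "j \<in> V" "i \<noteq> j" "x \<in> peirce i j"
    have "S x \<in> peirce i j"
      using off_diagonal_peirce(1)[OF two S Se *(4,1,2,3)] .
    moreover have "\<Delta> x = \<zero>"
      using \<chi>_off_diagonal[OF *(4,1,2,3)] by (rule \<Delta>_vanish)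
    ultimately show "D x \<in> peirce i j"
      using peirceD(1) by (simp add: D_def minus_eq)
  qed
  \<comment> \<open>The inner derivation removed at the beginning is put back into the derivation
    part.\<close>
  then have "derivation A (\<lambda>x. D x \<oplus> commutator A a x)"
    using derivation_inner[OF a] by (rule derivation_add)
  moreover have "T x = (D x \<oplus> commutator A a x) \<oplus> \<Delta> x" if "x \<in> carrier A" for x
  proof -
    have c: "T x \<in> carrier A" "\<Delta> x \<in> carrier A" "commutator A a x \<in> carrier A"
      using that a \<Delta>_closed linear_mapD(1)[OF lie_derivationD(1)[OF assms(2)]] by auto
    then show ?thesis unfolding D_def S_def by algebra
  qed
  ultimately show ?thesis
    unfolding standard_decomposition_def
    using \<open>linear_map A \<Delta>\<close> \<Delta>_fun \<Delta>_commutator by blast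
qed

text \<open>For off-diagonal \<open>x\<close> one has \<open>x = [e i, x]\<close>. For an
  idempotent, centrality turns the Leibniz rule into \<open>d (e i) = y + y\<close> with
  \<open>y = e i d (e i)\<close>; multiplying by \<open>e i\<close> gives \<open>y = y + y\<close>,
  so \<open>y\<close> and then \<open>d (e i)\<close> are zero. Loops follow from their off-diagonal
  factors.\<close>

lemma central_derivation_zero:
  assumes d: "derivation A d" and "d \<in> carrier A \<rightarrow> center A"
    and comm: "\<And>x y. x \<in> carrier A \<Longrightarrow> y \<in> carrier A \<Longrightarrow> d (commutator A x y) = \<zero>"
    and "x \<in> carrier A"
  shows "d x = \<zero>"
proof -
  note lin = derivationD(1)[OF d]
  have off: "d x = \<zero>" if "i \<in> V" "j \<in> V" "i \<noteq> j" "x \<in> peirce i j" for i j x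
  proof -
    have "commutator A (e i) x = x"
      using commutator_e_peirce[OF that(4,1,1,2)] that peirceD(1)[OF that(4)] by (simp add: minus_eq)
    then show ?thesis using comm[of "e i" x] that peirceD(1)[OF that(4)] by simp
  qed
  have e: "d (e i) = \<zero>" if i: "i \<in> V" for i
  proof -
    have z: "d (e i) \<in> carrier A" "d (e i) \<otimes> e i = e i \<otimes> d (e i)"
      using assms(2) i by (auto simp: center_def)
    have "d (e i) = e i \<otimes> d (e i) \<oplus> e i \<otimes> d (e i)"
      using derivationD(2)[OF d, of "e i" "e i"] i z by (simp add: e_mult)
    then have "e i \<otimes> d (e i) = e i \<otimes> (e i \<otimes> d (e i) \<oplus> e i \<otimes> d (e i))" by simp
    also have "\<dots> = e i \<otimes> d (e i) \<oplus> e i \<otimes> d (e i)"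
      using i z by (simp add: r_distr e_mult_left)
    finally have "e i \<otimes> d (e i) = \<zero>"
      using add.r_cancel_one'[of "e i \<otimes> d (e i)" "e i \<otimes> d (e i)"] i z(1) by blast
    then show ?thesis using \<open>d (e i) = e i \<otimes> d (e i) \<oplus> e i \<otimes> d (e i)\<close> by simp
  qed
  have loop: "d b = \<zero>" if "i \<in> V" "b \<in> loops i" for i b
  proof (rule loopsE[OF that(2)])
    fix q p m assume *: "b = q \<otimes> p" "m \<in> V" "m \<noteq> i" "q \<in> peirce i m" "p \<in> peirce m i"
    then show ?thesis
      using derivationD(2)[OF d, of q p] off[of i m q] off[of m i p] that(1) peirceD(1) by simp
  qed
  show ?thesis using assms(4)
  proof (induction rule: span_induct)
    case (basis b) then show ?case using B_cases[OF basis] off e loop by blast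
  qed (simp_all add: linear_map_zero[OF lin] linear_mapD[OF lin])
qed

text \<open>The difference \<open>D - D'\<close> is a derivation and equals
  \<open>\<Delta>' - \<Delta>\<close>, hence has central values and kills commutators; such a
  derivation is zero.\<close>

theorem standard_decomposition_unique:
  assumes "standard_decomposition A T D \<Delta>" "standard_decomposition A T D' \<Delta>'" "x \<in> carrier A"
  shows "D x = D' x" "\<Delta> x = \<Delta>' x"
proof -
  have D: "derivation A D" "derivation A D'" and "\<Delta> \<in> carrier A \<rightarrow> center A" "\<Delta>' \<in> carrier A \<rightarrow> center A"
    and \<Delta>_comm: "\<And>x y. x \<in> carrier A \<Longrightarrow> y \<in> carrier A \<Longrightarrow> \<Delta> (commutator A x y) = \<zero>"
      "\<And>x y. x \<in> carrier A \<Longrightarrow> y \<in> carrier A \<Longrightarrow> \<Delta>' (commutator A x y) = \<zero>"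
    and T: "\<And>x. x \<in> carrier A \<Longrightarrow> T x = D x \<oplus> \<Delta> x" "\<And>x. x \<in> carrier A \<Longrightarrow> T x = D' x \<oplus> \<Delta>' x"
    using assms(1,2) unfolding standard_decomposition_def by auto
  note lin = derivationD(1)[OF D(1)] derivationD(1)[OF D(2)]
  have \<Delta>_center: "\<Delta> x \<in> center A" "\<Delta>' x \<in> center A" if "x \<in> carrier A" for x
    using that \<open>\<Delta> \<in> carrier A \<rightarrow> center A\<close> \<open>\<Delta>' \<in> carrier A \<rightarrow> center A\<close> by auto
  have c: "D x \<in> carrier A" "D' x \<in> carrier A" "\<Delta> x \<in> carrier A" "\<Delta>' x \<in> carrier A"
    if "x \<in> carrier A" for x
    using that linear_mapD(1)[OF lin(1)] linear_mapD(1)[OF lin(2)] \<Delta>_center by (auto simp: center_def)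
  have diff: "D x \<ominus> D' x = \<Delta>' x \<ominus> \<Delta> x" if x: "x \<in> carrier A" for x
  proof -
    have "D x \<ominus> D' x = (D x \<oplus> \<Delta> x) \<ominus> D' x \<ominus> \<Delta> x" using c[OF x] by algebra
    also have "\<dots> = (D' x \<oplus> \<Delta>' x) \<ominus> D' x \<ominus> \<Delta> x" using T x by metis
    also have "\<dots> = \<Delta>' x \<ominus> \<Delta> x" using c[OF x] by algebra
    finally show ?thesis .
  qed
  have "D x \<ominus> D' x = \<zero>"
  proof (rule central_derivation_zero[OF derivation_sub[OF D] _ _ assms(3)])
    have "\<Delta>' y \<ominus> \<Delta> y \<in> center A" if "y \<in> carrier A" for y
      using \<Delta>_center[OF that]
      by (auto simp: center_def minus_eq l_distr r_distr l_minus r_minus)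
    then show "(\<lambda>x. D x \<ominus> D' x) \<in> carrier A \<rightarrow> center A" by (auto simp: diff)
    show "D (commutator A u v) \<ominus> D' (commutator A u v) = \<zero>"
      if "u \<in> carrier A" "v \<in> carrier A" for u v
      using that by (simp add: diff \<Delta>_comm minus_eq_zero_iff)
  qed
  then show "D x = D' x" using c[OF assms(3)] by (simp add: minus_eq_zero_iff)
  then show "\<Delta> x = \<Delta>' x" using T[OF assms(3)] c[OF assms(3)] by simp
qed

end

section \<open>Path algebras and their quotients\<close>

text \<open>Updating at a fresh key is the addition of a single term. Keeping the support inside
  \<open>S\<close> throughout lets multilinear identities be reduced to single paths, with
  \<open>S\<close> either everything or the paths of a quiver.\<close>

lemma poly_mapping_span_induct [consumes 1, case_names zero single add]:
  fixes f :: "'b \<Rightarrow>\<^sub>0 'c::comm_monoid_add"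
  assumes "Poly_Mapping.keys f \<subseteq> S"
    and "P 0"
    and "\<And>k c. k \<in> S \<Longrightarrow> P (Poly_Mapping.single k c)"
    and "\<And>f g. Poly_Mapping.keys f \<subseteq> S \<Longrightarrow> Poly_Mapping.keys g \<subseteq> S \<Longrightarrow> P f \<Longrightarrow> P g \<Longrightarrow> P (f + g)"
  shows "P f"
  using assms(1)
proof (induction f rule: update_induct)
  case const show ?case by (rule assms(2))
next
  case (update f a b)
  have eq: "Poly_Mapping.update a b f = Poly_Mapping.single a b + f"
    using update.hyps(1)
    by (intro poly_mapping_eqI) (auto simp: lookup_update lookup_add lookup_single when_def in_keys_iff)
  have "a \<in> S" "Poly_Mapping.keys f \<subseteq> S"
    using update.prems update.hyps by (auto simp: keys_update)
  then show ?case
    unfolding eq using update.IH assms(3) by (intro assms(4)) auto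
qed

lemma keys_add_subset:
  "Poly_Mapping.keys f \<subseteq> S \<Longrightarrow> Poly_Mapping.keys g \<subseteq> S \<Longrightarrow> Poly_Mapping.keys (f + g) \<subseteq> S"
  using keys_add[of f g] by blast

section \<open>Products of linear combinations of paths\<close>

definition path_prod :: "('v, 'a) path \<Rightarrow> ('v, 'a) path \<Rightarrow> 'k \<Rightarrow> ('v, 'a, 'k::field) path_comb" where
  "path_prod x y c = (case x of (u, p, v) \<Rightarrow> case y of (u', q, v') \<Rightarrow>
     if v' = u then Poly_Mapping.single (u', q @ p, v) c else 0)"

lemma path_prod_zero [simp]: "path_prod x y 0 = 0"
  by (simp add: path_prod_def split: prod.splits)

lemma path_prod_add: "path_prod x y (c + d) = path_prod x y c + path_prod x y d"
  by (simp add: path_prod_def single_add split: prod.splits)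

text \<open>Cancellation can make the support of a sum smaller than the union of the supports.
  Summing over a common finite superset lets additivity be checked term by term.\<close>

lemma path_times_superset:
  fixes f g :: "('v, 'a, 'k::field) path_comb"
  assumes "finite S" "Poly_Mapping.keys f \<subseteq> S" "finite S'" "Poly_Mapping.keys g \<subseteq> S'"
  shows "path_times f g = (\<Sum>x\<in>S. \<Sum>y\<in>S'. path_prod x y (Poly_Mapping.lookup f x * Poly_Mapping.lookup g y))"
proof -
  have "path_times f g = (\<Sum>x\<in>Poly_Mapping.keys f. \<Sum>y\<in>Poly_Mapping.keys g.
      path_prod x y (Poly_Mapping.lookup f x * Poly_Mapping.lookup g y))"
    unfolding path_times_def path_prod_def by (intro sum.cong) (auto intro!: sum.cong)
  also have "\<dots> = (\<Sum>x\<in>Poly_Mapping.keys f. \<Sum>y\<in>S'.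
      path_prod x y (Poly_Mapping.lookup f x * Poly_Mapping.lookup g y))"
    using assms by (intro sum.cong sum.mono_neutral_left) (auto simp: in_keys_iff)
  also have "\<dots> = (\<Sum>x\<in>S. \<Sum>y\<in>S'. path_prod x y (Poly_Mapping.lookup f x * Poly_Mapping.lookup g y))"
    using assms by (intro sum.mono_neutral_left) (auto simp: in_keys_iff)
  finally show ?thesis .
qed

lemma path_times_add_left: "path_times (f + g) h = path_times f h + path_times g h"
proof -
  let ?S = "Poly_Mapping.keys f \<union> Poly_Mapping.keys g"
  have "Poly_Mapping.keys (f + g) \<subseteq> ?S" by (rule keys_add)
  then show ?thesis
    by (simp add: path_times_superset[of ?S _ "Poly_Mapping.keys h"] lookup_add distrib_right
        path_prod_add sum.distrib)
qed

lemma path_times_add_right: "path_times h (f + g) = path_times h f + path_times h g"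
proof -
  let ?S = "Poly_Mapping.keys f \<union> Poly_Mapping.keys g"
  have "Poly_Mapping.keys (f + g) \<subseteq> ?S" by (rule keys_add)
  then show ?thesis
    by (simp add: path_times_superset[of "Poly_Mapping.keys h" _ ?S] lookup_add distrib_left
        path_prod_add sum.distrib)
qed

lemma path_times_zero [simp]: "path_times 0 f = 0" "path_times f 0 = 0"
  by (simp_all add: path_times_def)

lemma path_times_single:
  "path_times (Poly_Mapping.single (u, p, v) a) (Poly_Mapping.single (u', q, v') b) =
     (if v' = u then Poly_Mapping.single (u', q @ p, v) (a * b) else 0)"
  by (simp add: path_times_superset[of "{(u, p, v)}" _ "{(u', q, v')}"] path_prod_def)

text \<open>For three single paths this is associativity of list concatenation together with
  matching end points; linearity then frees one argument after the other, from right to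
  left.\<close>

lemma path_times_assoc:
  fixes f g h :: "('v, 'a, 'k::field) path_comb"
  shows "path_times (path_times f g) h = path_times f (path_times g h)"
proof -
  have 1: "path_times (path_times (Poly_Mapping.single x a) (Poly_Mapping.single y b)) (Poly_Mapping.single z c) =
     path_times (Poly_Mapping.single x a) (path_times (Poly_Mapping.single y b) (Poly_Mapping.single z c))"
    for x y z :: "('v, 'a) path" and a b c :: 'k
    by (cases x; cases y; cases z) (simp add: path_times_single mult.assoc)
  have 2: "path_times (path_times (Poly_Mapping.single x a) (Poly_Mapping.single y b)) h =
     path_times (Poly_Mapping.single x a) (path_times (Poly_Mapping.single y b) h)" for x y a b
    using subset_UNIV[of "Poly_Mapping.keys h"]
    by (induction h rule: poly_mapping_span_induct) (simp_all add: 1 path_times_add_right)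
  have 3: "path_times (path_times (Poly_Mapping.single x a) g) h =
     path_times (Poly_Mapping.single x a) (path_times g h)" for x a
    using subset_UNIV[of "Poly_Mapping.keys g"]
    by (induction g rule: poly_mapping_span_induct) (simp_all add: 2 path_times_add_right path_times_add_left)
  show ?thesis
    using subset_UNIV[of "Poly_Mapping.keys f"]
    by (induction f rule: poly_mapping_span_induct) (simp_all add: 3 path_times_add_left)
qed

definition scale :: "'k::field \<Rightarrow> ('b \<Rightarrow>\<^sub>0 'k) \<Rightarrow> ('b \<Rightarrow>\<^sub>0 'k)" where
  "scale c f = Poly_Mapping.map ((*) c) f"

lemma lookup_scale: "Poly_Mapping.lookup (scale c f) k = c * Poly_Mapping.lookup f k"
  by (auto simp: scale_def Poly_Mapping.map.rep_eq when_def)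

lemma keys_scale: "Poly_Mapping.keys (scale c f) \<subseteq> Poly_Mapping.keys f"
  by (auto simp: in_keys_iff lookup_scale)

lemma scale_algebra:
  "scale c (f + g) = scale c f + scale c g" "scale (c + d) f = scale c f + scale d f"
  "scale (c * d) f = scale c (scale d f)" "scale 1 f = f" "scale c 0 = 0"
  by (auto intro!: poly_mapping_eqI simp: lookup_scale lookup_add algebra_simps)

lemma scale_single: "scale c (Poly_Mapping.single k d) = Poly_Mapping.single k (c * d)"
  by (auto intro!: poly_mapping_eqI simp: lookup_scale lookup_single when_def)

lemma path_times_scale:
  fixes f g :: "('v, 'a, 'k::field) path_comb"
  shows "path_times (scale c f) g = scale c (path_times f g)" (is ?L)
    and "path_times f (scale c g) = scale c (path_times f g)" (is ?R)
proof -
  have 1: "path_times (scale c (Poly_Mapping.single x a)) (Poly_Mapping.single y b) =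
      scale c (path_times (Poly_Mapping.single x a) (Poly_Mapping.single y b)) \<and>
    path_times (Poly_Mapping.single x a) (scale c (Poly_Mapping.single y b)) =
      scale c (path_times (Poly_Mapping.single x a) (Poly_Mapping.single y b))"
    for x y :: "('v, 'a) path" and a b
    by (cases x; cases y) (simp add: path_times_single scale_single scale_algebra mult.assoc mult.left_commute)
  have 2: "path_times (scale c (Poly_Mapping.single x a)) g = scale c (path_times (Poly_Mapping.single x a) g) \<and>
      path_times (Poly_Mapping.single x a) (scale c g) = scale c (path_times (Poly_Mapping.single x a) g)" for x a
    using subset_UNIV[of "Poly_Mapping.keys g"]
    by (induction g rule: poly_mapping_span_induct) (simp_all add: 1 path_times_add_right scale_algebra)
  have "?L \<and> ?R"
    using subset_UNIV[of "Poly_Mapping.keys f"]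
    by (induction f rule: poly_mapping_span_induct) (simp_all add: 2 path_times_add_left scale_algebra)
  then show ?L ?R by auto
qed

context wf_digraph
begin

lemma paths_append:
  "(u, p, v) \<in> paths G \<Longrightarrow> (v, q, w) \<in> paths G \<Longrightarrow> (u, p @ q, w) \<in> paths G"
  by (auto simp: paths_def awalk_appendI)

lemma keys_path_times:
  assumes "Poly_Mapping.keys f \<subseteq> paths G" "Poly_Mapping.keys g \<subseteq> paths G"
  shows "Poly_Mapping.keys (path_times f g) \<subseteq> paths G"
proof -
  have 1: "Poly_Mapping.keys (path_times (Poly_Mapping.single x a) (Poly_Mapping.single y b)) \<subseteq> paths G"
    if "x \<in> paths G" "y \<in> paths G" for x y a b
    using that by (cases x; cases y) (auto simp: path_times_single paths_append split: if_splits)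
  have 2: "Poly_Mapping.keys (path_times (Poly_Mapping.single x a) g) \<subseteq> paths G" if "x \<in> paths G" for x a
    using assms(2) that
    by (induction g rule: poly_mapping_span_induct)
       (simp_all add: 1 path_times_add_right keys_add_subset)
  show ?thesis
    using assms(1)
    by (induction f rule: poly_mapping_span_induct)
       (simp_all add: 2 path_times_add_left keys_add_subset)
qed

end

section \<open>The path algebra of a finite quiver\<close>

lemma path_algebra_simps:
  "carrier (path_algebra G) = {f. Poly_Mapping.keys f \<subseteq> paths G}"
  "mult (path_algebra G) = path_times"
  "one (path_algebra G) = (\<Sum>i\<in>verts G. Poly_Mapping.single (i, [], i) 1)"
  "zero (path_algebra G) = 0"
  "add (path_algebra G) = (+)"
  "smult (path_algebra G) = scale"
  by (simp_all add: path_algebra_def scale_def[abs_def])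

lemma (in fin_digraph) kalgebra_path_algebra:
  "kalgebra (path_algebra G :: ('k::field, ('a, 'b, 'k) path_comb) module)"
proof -
  let ?A = "path_algebra G :: ('k::field, ('a, 'b, 'k) path_comb) module"
  let ?one = "(\<Sum>i\<in>verts G. Poly_Mapping.single (i, [], i) 1) :: ('a, 'b, 'k) path_comb"
  have triv: "(i, [], i) \<in> paths G" if "i \<in> verts G" for i
    using that by (simp add: paths_def awalk_Nil_iff)
  have ends: "u \<in> verts G" "v \<in> verts G" if "(u, p, v) \<in> paths G" for u p v
    using that awalk_hd_in_verts awalk_last_in_verts unfolding paths_def by blast+
  have one_closed: "Poly_Mapping.keys ?one \<subseteq> paths G"
  proof (rule subset_trans[OF keys_sum])
    show "(\<Union>i\<in>verts G. Poly_Mapping.keys (Poly_Mapping.single (i, [], i) (1::'k))) \<subseteq> paths G"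
      using triv by auto
  qed
  have sum_left: "path_times (sum h S) f = (\<Sum>i\<in>S. path_times (h i) f)"
    and sum_right: "path_times f (sum h S) = (\<Sum>i\<in>S. path_times f (h i))"
    for h :: "'a \<Rightarrow> ('a, 'b, 'k) path_comb" and S f
    by (induction S rule: infinite_finite_induct) (auto simp: path_times_add_left path_times_add_right)
  \<comment> \<open>Multiplying a path by the sum of all trivial paths, exactly one summand survives
    on each side: the one at the end vertex on the left, the one at the start vertex on the
    right.\<close>
  have one_left: "path_times ?one f = f" and one_right: "path_times f ?one = f"
    if "Poly_Mapping.keys f \<subseteq> paths G" for f
    using that
  proof (induction f rule: poly_mapping_span_induct)
    case (single k c)
    obtain u p v where k: "k = (u, p, v)" by (cases k)
    {
      case 1 then show ?case
        using ends[of u p v] single by (simp add: k sum_left path_times_single)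
    next
      case 2 then show ?case
        using ends[of u p v] single by (simp add: k sum_right path_times_single eq_commute)
    }
  qed (simp_all add: path_times_add_left path_times_add_right)
  have "ring ?A"
  proof (rule ringI)
    show "abelian_group ?A"
    proof (rule abelian_groupI)
      show "\<exists>y\<in>carrier ?A. y \<oplus>\<^bsub>?A\<^esub> x = \<zero>\<^bsub>?A\<^esub>" if "x \<in> carrier ?A" for x
        using that by (intro bexI[of _ "- x"]) (auto simp: path_algebra_simps in_keys_iff)
    qed (auto simp: path_algebra_simps ac_simps dest: subsetD[OF keys_add_subset])
    show "monoid ?A"
      by (rule monoidI)
         (use one_closed in \<open>auto simp: path_algebra_simps one_left one_right path_times_assoc
            dest: subsetD[OF keys_path_times]\<close>)
  qed (simp_all add: path_algebra_simps path_times_add_left path_times_add_right)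
  moreover have "kalgebra_axioms ?A"
    by (rule kalgebra_axioms.intro)
       (auto simp: path_algebra_simps scale_algebra path_times_scale dest: subsetD[OF keys_scale])
  ultimately show ?thesis by (rule kalgebra.intro)
qed

section \<open>Quotients by two-sided ideals\<close>

lemma quotient_algebra_simps:
  "carrier (quotient_algebra A I) = a_rcosets\<^bsub>A\<^esub> I"
  "mult (quotient_algebra A I) = rcoset_mult A I"
  "one (quotient_algebra A I) = I +>\<^bsub>A\<^esub> \<one>\<^bsub>A\<^esub>"
  "zero (quotient_algebra A I) = I"
  "add (quotient_algebra A I) = set_add A"
  "smult (quotient_algebra A I) = (\<lambda>c X. \<Union>x\<in>X. I +>\<^bsub>A\<^esub> (c \<odot>\<^bsub>A\<^esub> x))"
  by (simp_all add: quotient_algebra_def FactRing_def ring.defs module.defs)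

context kalgebra
begin

text \<open>A ring ideal of a unital algebra is a subspace, because scaling by \<open>c\<close> is
  multiplication by \<open>c \<odot> \<one>\<close>.\<close>

lemma ideal_smult_closed:
  assumes "ideal I A" "x \<in> I" shows "c \<odot> x \<in> I"
proof -
  interpret ideal I A by fact
  have x: "x \<in> carrier A" using assms(2) by (rule a_Hcarr)
  have "c \<odot> x = (c \<odot> \<one>) \<otimes> x" using x by (simp add: smult_mult_left)
  also have "\<dots> \<in> I" using assms(2) by (intro I_l_closed) auto
  finally show ?thesis .
qed

lemma coset_eq_iff:
  assumes "ideal I A" "x \<in> carrier A" "y \<in> carrier A"
  shows "I +> x = I +> y \<longleftrightarrow> x \<ominus> y \<in> I"
  using quotient_eq_iff_same_a_r_cos[OF assms] by simp

text \<open>Every representative contributes the same coset to the union that defines scalar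
  multiplication, so the union collapses to that coset.\<close>

lemma quotient_smult:
  assumes I: "ideal I A" and x: "x \<in> carrier A"
  shows "c \<odot>\<^bsub>quotient_algebra A I\<^esub> (I +> x) = I +> (c \<odot> x)"
proof -
  interpret ideal I A by fact
  have "I +> (c \<odot> y) = I +> (c \<odot> x)" if "y \<in> I +> x" for y
  proof -
    have y: "y \<in> carrier A" using that x a_r_coset_subset_G[OF a_subset] by blast
    have "I +> y = I +> x" using a_repr_independence'[OF that x] by simp
    then have "c \<odot> (y \<ominus> x) \<in> I"
      using coset_eq_iff[OF I y x] ideal_smult_closed[OF I] by simp
    then show ?thesis
      using coset_eq_iff[OF I, of "c \<odot> y" "c \<odot> x"] x y by (simp add: smult_a_minus)
  qed
  moreover have "x \<in> I +> x" using x by (rule a_rcos_self)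
  ultimately have "(\<Union>y\<in>I +> x. I +> (c \<odot> y)) = I +> (c \<odot> x)"
    using SUP_eq_const[of "I +> x" "\<lambda>y. I +> (c \<odot> y)"] by blast
  then show ?thesis by (simp only: quotient_algebra_simps)
qed

lemma quotient_coset:
  assumes I: "ideal I A" and x: "x \<in> carrier A" and y: "y \<in> carrier A"
  shows "I +> x \<in> carrier (quotient_algebra A I)"
    "(I +> x) \<oplus>\<^bsub>quotient_algebra A I\<^esub> (I +> y) = I +> (x \<oplus> y)"
    "(I +> x) \<otimes>\<^bsub>quotient_algebra A I\<^esub> (I +> y) = I +> (x \<otimes> y)"
proof -
  interpret ideal I A by fact
  show "I +> x \<in> carrier (quotient_algebra A I)"
    "(I +> x) \<oplus>\<^bsub>quotient_algebra A I\<^esub> (I +> y) = I +> (x \<oplus> y)"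
    "(I +> x) \<otimes>\<^bsub>quotient_algebra A I\<^esub> (I +> y) = I +> (x \<otimes> y)"
    using x y a_rcosetsI[OF a_subset] a_rcos_sum rcoset_mult_add
    by (auto simp: quotient_algebra_simps)
qed

lemma quotient_carrierE:
  assumes "X \<in> carrier (quotient_algebra A I)"
  obtains x where "x \<in> carrier A" "X = I +> x"
  using assms by (auto simp: quotient_algebra_simps A_RCOSETS_def' a_r_coset_def r_coset_def)

lemma quotient_zero_iff:
  assumes I: "ideal I A" and x: "x \<in> carrier A"
  shows "I +> x = \<zero>\<^bsub>quotient_algebra A I\<^esub> \<longleftrightarrow> x \<in> I"
proof -
  have "I +> \<zero> = I"
    by (rule a_rcos_zero[OF I]) (rule additive_subgroup.zero_closed[OF ideal.axioms(1)[OF I]])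
  then show ?thesis
    using coset_eq_iff[OF I x zero_closed] x by (simp add: quotient_algebra_simps minus_eq)
qed

text \<open>The ring operations are those of \<open>A Quot I\<close> in an extended record, so the
  ring axioms transfer from there; the scalar axioms are checked on representatives.\<close>

lemma kalgebra_quotient:
  assumes I: "ideal I A" shows "kalgebra (quotient_algebra A I)"
proof -
  interpret ideal I A by fact
  interpret Q: ring "A Quot I" by (rule quotient_is_ring)
  let ?Q = "quotient_algebra A I"
  have Q: "carrier ?Q = carrier (A Quot I)" "mult ?Q = mult (A Quot I)" "one ?Q = one (A Quot I)"
    "zero ?Q = zero (A Quot I)" "add ?Q = add (A Quot I)"
    by (simp_all add: quotient_algebra_simps FactRing_def)
  have "ring ?Q"
  proof (rule ringI)
    show "abelian_group ?Q"
      by (rule abelian_groupI) (use Q.l_neg in \<open>auto simp: Q Q.a_ac intro: Q.a_inv_closed\<close>)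
    show "monoid ?Q"
      by (rule monoidI) (simp_all add: Q Q.m_assoc)
  qed (simp_all add: Q Q.l_distr Q.r_distr)
  moreover have "kalgebra_axioms ?Q"
    by (rule kalgebra_axioms.intro)
       (auto elim!: quotient_carrierE simp: quotient_smult[OF I] quotient_coset[OF I]
          smult_l_distr smult_r_distr smult_assoc smult_one smult_mult_left smult_mult_right)
  ultimately show ?thesis by (rule kalgebra.intro)
qed

end

section \<open>Dual extensions\<close>

text \<open>A concatenation is trivial only if both factors are. This multiplicativity is the source
  of the characters of the dual extension.\<close>

lemma (in wf_digraph) lookup_path_times_trivial:
  fixes f g :: "('a, 'b, 'k::field) path_comb"
  assumes "Poly_Mapping.keys f \<subseteq> paths G" "Poly_Mapping.keys g \<subseteq> paths G"
  shows "Poly_Mapping.lookup (path_times f g) (i, [], i) =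
    Poly_Mapping.lookup f (i, [], i) * Poly_Mapping.lookup g (i, [], i)"
proof -
  have 1: "Poly_Mapping.lookup (path_times (Poly_Mapping.single x a) (Poly_Mapping.single y b)) (i, [], i) =
    Poly_Mapping.lookup (Poly_Mapping.single x a) (i, [], i) * Poly_Mapping.lookup (Poly_Mapping.single y b) (i, [], i)"
    if "x \<in> paths G" "y \<in> paths G" for x y and a b :: 'k
    using that by (cases x; cases y)
      (auto simp: path_times_single lookup_single when_def paths_def awalk_Nil_iff)
  have 2: "Poly_Mapping.lookup (path_times (Poly_Mapping.single x a) g) (i, [], i) =
    Poly_Mapping.lookup (Poly_Mapping.single x a) (i, [], i) * Poly_Mapping.lookup g (i, [], i)"
    if "x \<in> paths G" for x and a :: 'k
    using assms(2) that
    by (induction g rule: poly_mapping_span_induct)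
       (simp_all add: 1 path_times_add_right lookup_add distrib_left)
  show ?thesis
    using assms(1)
    by (induction f rule: poly_mapping_span_induct)
       (simp_all add: 2 path_times_add_left lookup_add distrib_right)
qed

lemma keys_extend_linearly:
  "Poly_Mapping.keys (extend_linearly h f) \<subseteq> h ` Poly_Mapping.keys f"
  unfolding extend_linearly_def by (rule subset_trans[OF keys_sum]) auto

section \<open>Words and paths in the dual quiver\<close>

lemma dual_quiver_simps [simp]:
  "verts (dual_quiver G) = verts G"
  "arcs (dual_quiver G) = Orig ` arcs G \<union> Star ` arcs G"
  "tail (dual_quiver G) (Orig \<alpha>) = tail G \<alpha>" "tail (dual_quiver G) (Star \<alpha>) = head G \<alpha>"
  "head (dual_quiver G) (Orig \<alpha>) = head G \<alpha>" "head (dual_quiver G) (Star \<alpha>) = tail G \<alpha>"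
  by (simp_all add: dual_quiver_def)

text \<open>Lists are in order of traversal, so \<open>[Star \<beta>, Orig \<alpha>]\<close> is the
  relation \<open>\<alpha>\<beta>\<^sup>*\<close>, and a word avoiding it is the list of some
  \<open>q\<^sup>*p\<close>. In the induction, the forbidden pattern first arises when a starred
  arrow is put before a nonempty block of original ones.\<close>

lemma dual_word_cases:
  obtains (normal) p r where "l = map Orig p @ map Star r"
    | (zero) l1 l2 \<alpha> \<beta> where "l = l1 @ [Star \<beta>, Orig \<alpha>] @ l2"
proof -
  have "(\<exists>p r. l = map Orig p @ map Star r) \<or> (\<exists>l1 l2 \<alpha> \<beta>. l = l1 @ [Star \<beta>, Orig \<alpha>] @ l2)"
  proof (induction l)
    case Nil
    show ?case by simp
  next
    case (Cons x l)
    from Cons.IH show ?case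
    proof (elim disjE exE)
      fix l1 l2 \<alpha> \<beta> assume "l = l1 @ [Star \<beta>, Orig \<alpha>] @ l2"
      then have "x # l = (x # l1) @ [Star \<beta>, Orig \<alpha>] @ l2" by simp
      then show ?case by blast
    next
      fix p r assume l: "l = map Orig p @ map Star r"
      show ?case
      proof (cases x)
        case (Orig \<alpha>)
        then have "x # l = map Orig (\<alpha> # p) @ map Star r" using l by simp
        then show ?thesis by blast
      next
        case (Star \<beta>)
        show ?thesis
        proof (cases p)
          case Nil
          then have "x # l = map Orig [] @ map Star (\<beta> # r)" using l Star by simp
          then show ?thesis by blast
        next
          case (Cons \<alpha> p')
          then have "x # l = [] @ [Star \<beta>, Orig \<alpha>] @ (map Orig p' @ map Star r)" using l Star by simp
          then show ?thesis by blast
        qed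
      qed
    qed
  qed
  then show thesis using that by blast
qed

context wf_digraph
begin

lemma cas_Orig: "pre_digraph.cas (dual_quiver G) u (map Orig p) v \<longleftrightarrow> cas u p v"
  by (induction p arbitrary: u) (simp_all add: pre_digraph.cas.simps)

text \<open>Starred arrows run backwards, so a starred walk is a walk of the original quiver read
  from its other end.\<close>

lemma cas_Star: "pre_digraph.cas (dual_quiver G) u (map Star r) v \<longleftrightarrow> cas v (rev r) u"
proof (induction r arbitrary: u)
  case (Cons \<alpha> r)
  have "cas v (rev r) (tail G \<alpha>) \<longleftrightarrow> cas v (rev r) (awlast v (rev r)) \<and> awlast v (rev r) = tail G \<alpha>"
    using awlast_if_cas by metis
  then show ?case using Cons.IH by (auto simp: pre_digraph.cas.simps)
qed (auto simp: pre_digraph.cas.simps)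

lemma paths_Orig: "(u, map Orig p, v) \<in> paths (dual_quiver G) \<longleftrightarrow> (u, p, v) \<in> paths G"
  by (auto simp: paths_def pre_digraph.awalk_def cas_Orig)

lemma paths_Star: "(u, map Star r, v) \<in> paths (dual_quiver G) \<longleftrightarrow> u \<in> verts G \<and> (v, rev r, u) \<in> paths G"
proof -
  \<comment> \<open>Walks are only asked to start in a vertex, and reversal exchanges the ends, so
    each end has to be shown to be a vertex from the other.\<close>
  have "v \<in> verts G" if "u \<in> verts G" "set r \<subseteq> arcs G" "cas v (rev r) u"
  proof (cases "rev r")
    case (Cons \<alpha> r')
    then have "\<alpha> \<in> set (rev r)" by simp
    then have "\<alpha> \<in> arcs G" using that(2) by auto
    then show ?thesis using that(3) Cons by auto
  qed (use that in simp)
  moreover have "u \<in> verts G" if "v \<in> verts G" "set r \<subseteq> arcs G" "cas v (rev r) u"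
    using that awalk_last_in_verts[of v "rev r" u] by (simp add: awalk_def)
  ultimately show ?thesis
    by (auto simp: paths_def pre_digraph.awalk_def cas_Star)
qed

end

lemma (in fin_digraph) fin_digraph_dual_quiver: "fin_digraph (dual_quiver G)"
  by unfold_locales (auto split: dual_arrow.splits)

section \<open>The ideal of relations and the classes of paths\<close>

locale acyclic_quiver = fin_digraph \<Gamma> for \<Gamma> :: "('v, 'a) pre_digraph" +
  fixes \<rho> :: "('v, 'a, 'k::field) path_comb set"
  assumes acyclic: "\<not> (\<exists>p. closed_w p)"
    and relations: "\<forall>r\<in>\<rho>. is_relation \<Gamma> r"
begin

sublocale dual: fin_digraph "dual_quiver \<Gamma>"
  by (rule fin_digraph_dual_quiver)

abbreviation P :: "('k, ('v, 'a dual_arrow, 'k) path_comb) module" where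
  "P \<equiv> path_algebra (dual_quiver \<Gamma>)"

abbreviation "I \<equiv> Idl\<^bsub>P\<^esub> (dual_relations \<Gamma> \<rho>)"

abbreviation "A \<equiv> dual_extension \<Gamma> \<rho>"

sublocale P: kalgebra P
  by (rule dual.kalgebra_path_algebra)

lemma no_closed_path: "(u, p, u) \<in> paths \<Gamma> \<Longrightarrow> p = []"
  using acyclic by (auto simp: closed_w_def paths_def)

text \<open>This places every generator of the ideal among the combinations without trivial paths,
  which form an ideal themselves; hence no element of \<open>I\<close> involves a trivial
  path.\<close>

lemma keys_dual_relations:
  assumes "r \<in> dual_relations \<Gamma> \<rho>"
  shows "Poly_Mapping.keys r \<subseteq> {(u, p, v). (u, p, v) \<in> paths (dual_quiver \<Gamma>) \<and> p \<noteq> []}"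
    (is "_ \<subseteq> ?S")
  using assms unfolding dual_relations_def
proof (elim UnE imageE)
  have verts: "v \<in> verts \<Gamma>" if "(u, p, v) \<in> paths \<Gamma>" for u p v
    using that awalk_last_in_verts unfolding paths_def by blast
  have orig: "orig_path ` Poly_Mapping.keys s \<subseteq> ?S" and star: "star_path ` Poly_Mapping.keys s \<subseteq> ?S"
    if "s \<in> \<rho>" for s
  proof -
    from that relations have rel: "is_relation \<Gamma> s" by blast
    have *: "w \<in> paths \<Gamma> \<and> fst (snd w) \<noteq> []" if "w \<in> Poly_Mapping.keys s" for w
      using rel that unfolding is_relation_def by fastforce
    show "orig_path ` Poly_Mapping.keys s \<subseteq> ?S"
    proof
      fix x assume "x \<in> orig_path ` Poly_Mapping.keys s"
      then obtain u p v where "x = orig_path (u, p, v)" "(u, p, v) \<in> Poly_Mapping.keys s" by auto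
      then show "x \<in> ?S" using *[of "(u, p, v)"] by (simp add: paths_Orig)
    qed
    show "star_path ` Poly_Mapping.keys s \<subseteq> ?S"
    proof
      fix x assume "x \<in> star_path ` Poly_Mapping.keys s"
      then obtain u p v where "x = star_path (u, p, v)" "(u, p, v) \<in> Poly_Mapping.keys s" by auto
      then show "x \<in> ?S" using *[of "(u, p, v)"] verts[of u p v] by (simp add: rev_map paths_Star)
    qed
  qed
  {
    fix s assume s: "r = extend_linearly orig_path s" "s \<in> \<rho>"
    show ?thesis unfolding s(1) by (rule subset_trans[OF keys_extend_linearly orig[OF s(2)]])
  next
    fix s assume s: "r = extend_linearly star_path s" "s \<in> \<rho>"
    show ?thesis unfolding s(1) by (rule subset_trans[OF keys_extend_linearly star[OF s(2)]])
  next
    assume "r \<in> {arrow (dual_quiver \<Gamma>) (Orig \<alpha>) \<otimes>\<^bsub>P\<^esub> arrow (dual_quiver \<Gamma>) (Star \<beta>) |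
      \<alpha> \<beta>. \<alpha> \<in> arcs \<Gamma> \<and> \<beta> \<in> arcs \<Gamma>}"
    then show ?thesis
      by (auto simp: arrow_def path_algebra_simps path_times_single paths_def
          pre_digraph.awalk_def pre_digraph.cas.simps split: if_splits)
  }
qed

lemma ideal_without_trivial_paths:
  "ideal {f \<in> carrier P. \<forall>i. Poly_Mapping.lookup f (i, [], i) = 0} P" (is "ideal ?J P")
proof (rule idealI[OF P.ring_axioms])
  \<comment> \<open>The ring negation is an inverse in the additive monoid; it is identified with
    negation of finitely supported functions so that coefficients can be read off.\<close>
  have inv: "\<ominus>\<^bsub>P\<^esub> f = - f" if "f \<in> carrier P" for f
    using that by (intro P.minus_equality) (auto simp: path_algebra_simps)
  show "subgroup ?J (add_monoid P)"
  proof (rule P.add.subgroupI)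
    have "0 \<in> ?J" by (simp add: path_algebra_simps)
    then show "?J \<noteq> {}" by blast
    show "\<ominus>\<^bsub>P\<^esub> f \<in> ?J" if "f \<in> ?J" for f
      using that by (simp add: inv) (simp add: path_algebra_simps)
    show "f \<oplus>\<^bsub>P\<^esub> g \<in> ?J" if "f \<in> ?J" "g \<in> ?J" for f g
      using that by (simp add: path_algebra_simps lookup_add keys_add_subset)
  qed (simp add: subset_iff)
  show "g \<otimes>\<^bsub>P\<^esub> f \<in> ?J" "f \<otimes>\<^bsub>P\<^esub> g \<in> ?J" if "f \<in> ?J" "g \<in> carrier P" for f g
    using that by (simp_all add: path_algebra_simps dual.keys_path_times dual.lookup_path_times_trivial)
qed

lemma dual_relations_closed: "dual_relations \<Gamma> \<rho> \<subseteq> carrier P"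
  using keys_dual_relations by (fastforce simp: path_algebra_simps)

lemma ideal_I: "ideal I P"
  by (rule P.genideal_ideal[OF dual_relations_closed])

lemma I_trivial:
  assumes "f \<in> I" shows "Poly_Mapping.lookup f (i, [], i) = 0"
proof -
  have "dual_relations \<Gamma> \<rho> \<subseteq> {f \<in> carrier P. \<forall>i. Poly_Mapping.lookup f (i, [], i) = 0}"
    using keys_dual_relations dual_relations_closed by (fastforce simp: in_keys_iff)
  then show ?thesis
    using P.genideal_minimal[OF ideal_without_trivial_paths] assms by blast
qed

lemma A_eq: "A = quotient_algebra P I"
  by (simp add: dual_extension_def quiver_algebra_def)

text \<open>The coefficient is read from an arbitrary representative. Representatives of a coset
  differ by an element of \<open>I\<close>, which has no trivial paths, so the choice does not
  matter.\<close>

definition \<chi> :: "'v \<Rightarrow> ('v, 'a dual_arrow, 'k) path_comb set \<Rightarrow> 'k" where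
  "\<chi> i X = Poly_Mapping.lookup (SOME f. f \<in> X) (i, [], i)"

lemma \<chi>_coset:
  assumes "f \<in> carrier P" shows "\<chi> i (I +>\<^bsub>P\<^esub> f) = Poly_Mapping.lookup f (i, [], i)"
proof -
  interpret ideal I P by (rule ideal_I)
  have "(SOME g. g \<in> I +>\<^bsub>P\<^esub> f) \<in> I +>\<^bsub>P\<^esub> f"
    using a_rcos_self[OF assms] by (rule someI)
  then obtain h where "h \<in> I" "(SOME g. g \<in> I +>\<^bsub>P\<^esub> f) = h \<oplus>\<^bsub>P\<^esub> f"
    unfolding a_r_coset_def' by blast
  then show ?thesis
    using I_trivial by (simp add: \<chi>_def path_algebra_simps lookup_add)
qed

definition path_class :: "('v, 'a dual_arrow) path \<Rightarrow> ('v, 'a dual_arrow, 'k) path_comb set" where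
  "path_class w = I +>\<^bsub>P\<^esub> Poly_Mapping.single w 1"

lemma single_closed: "w \<in> paths (dual_quiver \<Gamma>) \<Longrightarrow> Poly_Mapping.single w c \<in> carrier P"
  by (simp add: path_algebra_simps)

lemma path_class_closed: "w \<in> paths (dual_quiver \<Gamma>) \<Longrightarrow> path_class w \<in> carrier A"
  unfolding path_class_def A_eq by (rule P.quotient_coset(1)[OF ideal_I single_closed single_closed])

lemma zero_A: "\<zero>\<^bsub>A\<^esub> = I +>\<^bsub>P\<^esub> 0"
proof -
  have "0 \<in> I" "(0 :: ('v, 'a dual_arrow, 'k) path_comb) \<in> carrier P"
    using additive_subgroup.zero_closed[OF ideal.axioms(1)[OF ideal_I]]
    by (simp_all add: path_algebra_simps)
  then show ?thesis using P.quotient_zero_iff[OF ideal_I, of 0] by (simp add: A_eq)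
qed

lemma path_class_mult:
  assumes "(u, p, v) \<in> paths (dual_quiver \<Gamma>)" "(u', q, v') \<in> paths (dual_quiver \<Gamma>)"
  shows "path_class (u, p, v) \<otimes>\<^bsub>A\<^esub> path_class (u', q, v') =
    (if v' = u then path_class (u', q @ p, v) else \<zero>\<^bsub>A\<^esub>)"
proof -
  have "path_class (u, p, v) \<otimes>\<^bsub>A\<^esub> path_class (u', q, v') =
    I +>\<^bsub>P\<^esub> (path_times (Poly_Mapping.single (u, p, v) 1) (Poly_Mapping.single (u', q, v') 1))"
    using P.quotient_coset(3)[OF ideal_I single_closed[OF assms(1)] single_closed[OF assms(2)], of 1 1]
    by (simp add: path_class_def A_eq path_algebra_simps)
  then show ?thesis
    by (simp add: path_times_single zero_A path_class_def)
qed

lemma path_span_induct [consumes 1, case_names zero path add smult]: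
  assumes "X \<in> carrier A" and "Q \<zero>\<^bsub>A\<^esub>"
    and "\<And>w. w \<in> paths (dual_quiver \<Gamma>) \<Longrightarrow> Q (path_class w)"
    and add: "\<And>X Y. X \<in> carrier A \<Longrightarrow> Y \<in> carrier A \<Longrightarrow> Q X \<Longrightarrow> Q Y \<Longrightarrow> Q (X \<oplus>\<^bsub>A\<^esub> Y)"
    and smult: "\<And>c X. X \<in> carrier A \<Longrightarrow> Q X \<Longrightarrow> Q (c \<odot>\<^bsub>A\<^esub> X)"
  shows "Q X"
proof -
  obtain f where f: "f \<in> carrier P" "X = I +>\<^bsub>P\<^esub> f"
    using assms(1) unfolding A_eq by (rule P.quotient_carrierE)
  from f(1) have "Poly_Mapping.keys f \<subseteq> paths (dual_quiver \<Gamma>)" by (simp add: path_algebra_simps)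
  then have "Q (I +>\<^bsub>P\<^esub> f)"
  proof (induction f rule: poly_mapping_span_induct)
    case zero
    show ?case using assms(2) by (simp add: zero_A)
  next
    case (single w c)
    have "c \<odot>\<^bsub>A\<^esub> path_class w = I +>\<^bsub>P\<^esub> Poly_Mapping.single w c"
      using P.quotient_smult[OF ideal_I single_closed[OF single], of c 1]
      by (simp add: path_class_def A_eq) (simp add: path_algebra_simps scale_single)
    then show ?case using smult[OF path_class_closed[OF single] assms(3)[OF single]] by metis
  next
    case (add g h)
    then have gh: "g \<in> carrier P" "h \<in> carrier P" by (simp_all add: path_algebra_simps)
    have "(I +>\<^bsub>P\<^esub> g) \<oplus>\<^bsub>A\<^esub> (I +>\<^bsub>P\<^esub> h) = I +>\<^bsub>P\<^esub> (g + h)"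
      using P.quotient_coset(2)[OF ideal_I gh] by (simp add: A_eq path_algebra_simps)
    moreover have "I +>\<^bsub>P\<^esub> g \<in> carrier A" "I +>\<^bsub>P\<^esub> h \<in> carrier A"
      using P.quotient_coset(1)[OF ideal_I] gh by (simp_all add: A_eq)
    ultimately show ?case using assms(4) add.IH by metis
  qed
  then show ?thesis by (simp add: f(2))
qed

lemma path_class_zero:
  assumes "(u, l1 @ [Star \<beta>, Orig \<alpha>] @ l2, v) \<in> paths (dual_quiver \<Gamma>)"
  shows "path_class (u, l1 @ [Star \<beta>, Orig \<alpha>] @ l2, v) = \<zero>\<^bsub>A\<^esub>"
proof -
  interpret ideal I P by (rule ideal_I)
  have walk: "dual.awalk u (l1 @ [Star \<beta>, Orig \<alpha>] @ l2) v"
    using assms by (simp add: paths_def)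
  have arcs: "\<alpha> \<in> arcs \<Gamma>" "\<beta> \<in> arcs \<Gamma>"
    using walk by (auto simp: dual.awalk_def)
  have l: "dual.awalk u l1 (head \<Gamma> \<beta>)" "tail \<Gamma> \<beta> = tail \<Gamma> \<alpha>" "dual.awalk (head \<Gamma> \<alpha>) l2 v"
    using walk by (auto simp: dual.awalk_append_iff dual.awalk_Cons_iff)
  let ?r = "Poly_Mapping.single (head \<Gamma> \<beta>, [Star \<beta>, Orig \<alpha>], head \<Gamma> \<alpha>) 1 :: ('v, 'a dual_arrow, 'k) path_comb"
  have "?r = arrow (dual_quiver \<Gamma>) (Orig \<alpha>) \<otimes>\<^bsub>P\<^esub> arrow (dual_quiver \<Gamma>) (Star \<beta>)"
    using l(2) by (simp add: arrow_def path_algebra_simps path_times_single)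
  then have "?r \<in> dual_relations \<Gamma> \<rho>"
    using arcs unfolding dual_relations_def by blast
  then have r: "?r \<in> I"
    using P.genideal_self[OF dual_relations_closed] by blast
  \<comment> \<open>The whole path is the relation multiplied by the remaining pieces; the piece
    traversed last is the left factor.\<close>
  have "Poly_Mapping.single (head \<Gamma> \<alpha>, l2, v) 1 \<otimes>\<^bsub>P\<^esub> (?r \<otimes>\<^bsub>P\<^esub> Poly_Mapping.single (u, l1, head \<Gamma> \<beta>) 1) \<in> I"
    using l by (intro I_l_closed I_r_closed r single_closed) (simp_all add: paths_def)
  then have "Poly_Mapping.single (u, l1 @ [Star \<beta>, Orig \<alpha>] @ l2, v) 1 \<in> I"
    by (simp add: path_algebra_simps path_times_single)
  then show ?thesis
    using P.quotient_zero_iff[OF ideal_I single_closed[OF assms]]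
    by (simp add: path_class_def A_eq)
qed

text \<open>A nonvanishing word is \<open>p\<close> followed by starred arrows, where
  \<open>p\<close> and \<open>rev r\<close> are paths of \<open>\<Gamma>\<close> from
  \<open>u\<close> to the turning point \<open>m\<close>. By acyclicity \<open>m = u\<close> would
  make both empty, and conversely one empty piece would force \<open>m = u\<close>.\<close>

lemma nonzero_closed_pathE:
  assumes "(u, l, u) \<in> paths (dual_quiver \<Gamma>)" "l \<noteq> []" "path_class (u, l, u) \<noteq> \<zero>\<^bsub>A\<^esub>"
  obtains p r m where "l = map Orig p @ map Star r" "p \<noteq> []" "r \<noteq> []" "m \<in> verts \<Gamma>" "m \<noteq> u"
    "(u, map Orig p, m) \<in> paths (dual_quiver \<Gamma>)" "(m, map Star r, u) \<in> paths (dual_quiver \<Gamma>)"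
proof (cases rule: dual_word_cases[of l])
  case (zero l1 l2 \<alpha> \<beta>)
  then show ?thesis using assms path_class_zero by metis
next
  case (normal p r)
  then have "dual.awalk u (map Orig p @ map Star r) u"
    using assms(1) by (simp add: paths_def)
  then obtain m where "dual.awalk u (map Orig p) m" "dual.awalk m (map Star r) u"
    unfolding dual.awalk_append_iff by blast
  then have m: "(u, map Orig p, m) \<in> paths (dual_quiver \<Gamma>)" "(m, map Star r, u) \<in> paths (dual_quiver \<Gamma>)"
    by (simp_all add: paths_def)
  have pr: "(u, p, m) \<in> paths \<Gamma>" "(u, rev r, m) \<in> paths \<Gamma>" and "m \<in> verts \<Gamma>"
    using m by (simp_all add: paths_Orig paths_Star)
  have "p = [] \<and> r = []" if "m = u"
    using no_closed_path[OF pr(1)[unfolded that]] no_closed_path[OF pr(2)[unfolded that]] by simp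
  moreover have "m = u" if "p = [] \<or> r = []"
    using pr that by (elim disjE) (simp_all add: paths_def awalk_Nil_iff)
  moreover have "\<not> (p = [] \<and> r = [])"
    using normal assms(2) by simp
  ultimately have "m \<noteq> u" "p \<noteq> []" "r \<noteq> []"
    by blast+
  with normal \<open>m \<in> verts \<Gamma>\<close> m show ?thesis by (intro that)
qed

definition e :: "'v \<Rightarrow> ('v, 'a dual_arrow, 'k) path_comb set" where
  "e i = path_class (i, [], i)"

lemma trivial_path: "i \<in> verts \<Gamma> \<Longrightarrow> (i, [], i) \<in> paths (dual_quiver \<Gamma>)"
  by (simp add: paths_def dual.awalk_Nil_iff)

lemma path_ends:
  assumes "(u, p, v) \<in> paths (dual_quiver \<Gamma>)" shows "u \<in> verts \<Gamma>" "v \<in> verts \<Gamma>"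
  using assms dual.awalk_hd_in_verts dual.awalk_last_in_verts unfolding paths_def by force+

end

section \<open>Idempotents and characters of the dual extension\<close>

sublocale acyclic_quiver \<subseteq> A: kalgebra A
  unfolding A_eq by (rule P.kalgebra_quotient[OF ideal_I])

sublocale acyclic_quiver \<subseteq> A: idempotent_kalgebra A "verts \<Gamma>" e
proof
  show "finite (verts \<Gamma>)" by simp
  show "e i \<in> carrier A" if "i \<in> verts \<Gamma>" for i
    using that by (simp add: e_def path_class_closed trivial_path)
  show "e i \<otimes>\<^bsub>A\<^esub> e j = (if i = j then e i else \<zero>\<^bsub>A\<^esub>)" if "i \<in> verts \<Gamma>" "j \<in> verts \<Gamma>" for i j
    using that by (simp add: e_def path_class_mult trivial_path)
  \<comment> \<open>The induction over subsets carries the support along, since addition of cosets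
    is computed on representatives in the carrier.\<close>
  have "finsum A e S = I +>\<^bsub>P\<^esub> (\<Sum>i\<in>S. Poly_Mapping.single (i, [], i) 1) \<and>
    Poly_Mapping.keys (\<Sum>i\<in>S. Poly_Mapping.single (i, [], i) (1::'k)) \<subseteq> paths (dual_quiver \<Gamma>)"
    if "finite S" "S \<subseteq> verts \<Gamma>" for S
    using that
  proof (induction S)
    case empty
    show ?case by (simp add: zero_A)
  next
    case (insert i S)
    let ?s = "\<Sum>i\<in>S. Poly_Mapping.single (i, [], i) (1::'k)"
    have e: "e \<in> S \<rightarrow> carrier A" "e i \<in> carrier A"
      using insert.prems by (auto simp: e_def path_class_closed trivial_path)
    have c: "?s \<in> carrier P" "Poly_Mapping.single (i, [], i) 1 \<in> carrier P"
      using insert.IH insert.prems trivial_path by (auto simp: path_algebra_simps)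
    have "finsum A e (insert i S) = e i \<oplus>\<^bsub>A\<^esub> (I +>\<^bsub>P\<^esub> ?s)"
      using insert e by simp
    also have "\<dots> = I +>\<^bsub>P\<^esub> (Poly_Mapping.single (i, [], i) 1 + ?s)"
      using P.quotient_coset(2)[OF ideal_I c(2,1)]
      by (simp add: e_def path_class_def A_eq path_algebra_simps)
    finally show ?case
      using insert.hyps c by (simp add: path_algebra_simps keys_add_subset)
  qed
  then show "finsum A e (verts \<Gamma>) = \<one>\<^bsub>A\<^esub>"
    by (simp add: A_eq quotient_algebra_simps path_algebra_simps)
qed

context acyclic_quiver
begin

lemma \<chi>_path_class:
  "w \<in> paths (dual_quiver \<Gamma>) \<Longrightarrow> \<chi> i (path_class w) = (if w = (i, [], i) then 1 else 0)"
  unfolding path_class_def by (subst \<chi>_coset[OF single_closed]) (auto simp: lookup_single when_def)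

end

sublocale acyclic_quiver \<subseteq> A: character_kalgebra A "verts \<Gamma>" e \<chi>
proof
  fix i X Y c assume "i \<in> verts \<Gamma>" "X \<in> carrier A"
  then obtain f where f: "f \<in> carrier P" "X = I +>\<^bsub>P\<^esub> f"
    unfolding A_eq by (elim P.quotient_carrierE)
  have "c \<odot>\<^bsub>A\<^esub> X = I +>\<^bsub>P\<^esub> (c \<odot>\<^bsub>P\<^esub> f)"
    using P.quotient_smult[OF ideal_I f(1)] by (simp add: f(2) A_eq)
  then show "\<chi> i (c \<odot>\<^bsub>A\<^esub> X) = c * \<chi> i X"
    using f \<chi>_coset[OF P.smult_closed[OF f(1)]] \<chi>_coset[OF f(1)]
    by (simp add: path_algebra_simps lookup_scale)
  assume "Y \<in> carrier A"
  then obtain g where g: "g \<in> carrier P" "Y = I +>\<^bsub>P\<^esub> g"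
    unfolding A_eq by (elim P.quotient_carrierE)
  have sum: "X \<oplus>\<^bsub>A\<^esub> Y = I +>\<^bsub>P\<^esub> (f \<oplus>\<^bsub>P\<^esub> g)" and prod: "X \<otimes>\<^bsub>A\<^esub> Y = I +>\<^bsub>P\<^esub> (f \<otimes>\<^bsub>P\<^esub> g)"
    using P.quotient_coset[OF ideal_I f(1) g(1)] by (simp_all add: f(2) g(2) A_eq)
  show "\<chi> i (X \<oplus>\<^bsub>A\<^esub> Y) = \<chi> i X + \<chi> i Y"
    unfolding sum unfolding f(2) g(2) \<chi>_coset[OF P.a_closed[OF f(1) g(1)]] \<chi>_coset[OF f(1)] \<chi>_coset[OF g(1)]
    by (simp add: path_algebra_simps lookup_add)
  show "\<chi> i (X \<otimes>\<^bsub>A\<^esub> Y) = \<chi> i X * \<chi> i Y"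
    unfolding prod unfolding f(2) g(2) \<chi>_coset[OF P.m_closed[OF f(1) g(1)]] \<chi>_coset[OF f(1)] \<chi>_coset[OF g(1)]
    using f(1) g(1) by (simp add: path_algebra_simps dual.lookup_path_times_trivial)
next
  fix i j assume "i \<in> verts \<Gamma>" "j \<in> verts \<Gamma>"
  then show "\<chi> i (e j) = (if i = j then 1 else 0)"
    by (auto simp: e_def \<chi>_path_class trivial_path)
qed

section \<open>Nonzero closed paths as loops\<close>

context acyclic_quiver
begin

text \<open>Products are read from right to left, so the end vertex gives the left index and the
  start vertex the right one.\<close>

lemma path_class_peirce:
  assumes "(u, p, v) \<in> paths (dual_quiver \<Gamma>)" shows "path_class (u, p, v) \<in> A.peirce v u"
  using assms path_ends[OF assms]
  by (simp add: A.peirce_def e_def path_class_closed path_class_mult trivial_path)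

lemma pc_path_class:
  assumes "(u, p, v) \<in> paths (dual_quiver \<Gamma>)" "i \<in> verts \<Gamma>" "j \<in> verts \<Gamma>"
  shows "A.pc i (path_class (u, p, v)) j = (if i = v \<and> j = u then path_class (u, p, v) else \<zero>\<^bsub>A\<^esub>)"
  using A.pc_of_peirce[OF path_class_peirce[OF assms(1)] assms(2,3) path_ends(2,1)[OF assms(1)]] by simp

text \<open>Allows a claim about one Peirce component to be proved for \<open>A.pc i x j\<close> by
  induction over all \<open>x\<close> in \<open>A\<close>.\<close>

lemma peirce_pc: "x \<in> A.peirce i j \<Longrightarrow> A.pc i x j = x"
  by (simp add: A.pc_def A.peirceD)

text \<open>A nonzero closed path turns once, from original to starred arrows, which gives the
  factors \<open>q\<close> and \<open>p\<close>. All conditions on them hold because a nonzero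
  nontrivial closed path starts with an original arrow and ends with a starred one.\<close>

lemma closed_path_class_loop:
  assumes path: "(u, l, u) \<in> paths (dual_quiver \<Gamma>)" and "l \<noteq> []" "path_class (u, l, u) \<noteq> \<zero>\<^bsub>A\<^esub>"
  shows "path_class (u, l, u) \<in> A.loops u"
proof (rule nonzero_closed_pathE[OF assms])
  fix p r m assume *: "l = map Orig p @ map Star r" "p \<noteq> []" "r \<noteq> []" "m \<in> verts \<Gamma>" "m \<noteq> u"
    "(u, map Orig p, m) \<in> paths (dual_quiver \<Gamma>)" "(m, map Star r, u) \<in> paths (dual_quiver \<Gamma>)"
  have u: "u \<in> verts \<Gamma>" using path_ends[OF path] by simp
  let ?p = "path_class (u, map Orig p, m)" and ?q = "path_class (m, map Star r, u)"
  have pq: "?p \<in> A.peirce m u" "?q \<in> A.peirce u m"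
    using path_class_peirce * by auto
  note c = A.peirceD(1)[OF pq(1)] A.peirceD(1)[OF pq(2)]
  have prod: "path_class (u, l, u) = ?q \<otimes>\<^bsub>A\<^esub> ?p"
    using * by (simp add: path_class_mult)
  \<comment> \<open>Traversing \<open>x\<close> first and then \<open>p\<close> yields a closed path
    at \<open>m\<close> whose last arrow is original, so its class vanishes.\<close>
  have p_zero: "?p \<otimes>\<^bsub>A\<^esub> A.pc u x m = \<zero>\<^bsub>A\<^esub>" if "x \<in> carrier A" for x
    using that
  proof (induction rule: path_span_induct)
    case (path w)
    obtain s l' t where w: "w = (s, l', t)" by (cases w)
    have "path_class (m, l' @ map Orig p, m) = \<zero>\<^bsub>A\<^esub>" if "(m, l', u) \<in> paths (dual_quiver \<Gamma>)"
    proof (rule ccontr)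
      assume "path_class (m, l' @ map Orig p, m) \<noteq> \<zero>\<^bsub>A\<^esub>"
      moreover have "(m, l' @ map Orig p, m) \<in> paths (dual_quiver \<Gamma>)"
        using that *(6) by (rule dual.paths_append)
      ultimately obtain p' r' where "l' @ map Orig p = map Orig p' @ map Star r'" "r' \<noteq> []"
        using *(2) by (elim nonzero_closed_pathE) auto
      then have "last (map Orig p) = last (map Star r')"
        using *(2) by (metis last_appendR map_is_Nil_conv)
      then show False using *(2) \<open>r' \<noteq> []\<close> by (simp add: last_map)
    qed
    then have zero: "path_class (m, l' @ map Orig p, m) = \<zero>\<^bsub>A\<^esub>" if "u = t \<and> m = s"
      using path that by (simp add: w)
    have "A.pc u (path_class w) m = (if u = t \<and> m = s then path_class w else \<zero>\<^bsub>A\<^esub>)"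
      using path u *(4) by (simp add: w pc_path_class)
    then show ?case
      using path *(6) c(1) zero by (cases "u = t \<and> m = s") (simp_all add: w path_class_mult)
  qed (use u * c in \<open>simp_all add: A.pc_add A.pc_smult A.r_distr A.smult_mult_right A.pc_def[of _ "\<zero>\<^bsub>A\<^esub>"]\<close>)
  \<comment> \<open>Here the closed path at \<open>m\<close> begins with a starred arrow, which is
    equally impossible for a nonzero class.\<close>
  have q_zero: "A.pc m x u \<otimes>\<^bsub>A\<^esub> ?q = \<zero>\<^bsub>A\<^esub>" if "x \<in> carrier A" for x
    using that
  proof (induction rule: path_span_induct)
    case (path w)
    obtain s l' t where w: "w = (s, l', t)" by (cases w)
    have "path_class (m, map Star r @ l', m) = \<zero>\<^bsub>A\<^esub>" if "(u, l', m) \<in> paths (dual_quiver \<Gamma>)"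
    proof (rule ccontr)
      assume "path_class (m, map Star r @ l', m) \<noteq> \<zero>\<^bsub>A\<^esub>"
      moreover have "(m, map Star r @ l', m) \<in> paths (dual_quiver \<Gamma>)"
        using *(7) that by (rule dual.paths_append)
      ultimately obtain p' r' where "map Star r @ l' = map Orig p' @ map Star r'" "p' \<noteq> []"
        using *(3) by (elim nonzero_closed_pathE) auto
      then have "hd (map Star r) = hd (map Orig p')"
        using *(3) by (metis hd_append2 map_is_Nil_conv)
      then show False using *(3) \<open>p' \<noteq> []\<close> by (simp add: hd_map)
    qed
    then have zero: "path_class (m, map Star r @ l', m) = \<zero>\<^bsub>A\<^esub>" if "m = t \<and> u = s"
      using path that by (simp add: w)
    have "A.pc m (path_class w) u = (if m = t \<and> u = s then path_class w else \<zero>\<^bsub>A\<^esub>)"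
      using path u *(4) by (simp add: w pc_path_class)
    then show ?case
      using path *(7) c(2) zero by (cases "m = t \<and> u = s") (simp_all add: w path_class_mult)
  qed (use u * c in \<open>simp_all add: A.pc_add A.pc_smult A.l_distr A.smult_mult_left A.pc_def[of _ "\<zero>\<^bsub>A\<^esub>"]\<close>)
  have act: "A.pc u x u \<otimes>\<^bsub>A\<^esub> ?q = \<chi> u x \<odot>\<^bsub>A\<^esub> ?q \<and> ?p \<otimes>\<^bsub>A\<^esub> A.pc u x u = \<chi> u x \<odot>\<^bsub>A\<^esub> ?p"
    if "x \<in> carrier A" for x
    using that
  proof (induction rule: path_span_induct)
    case (path w)
    obtain s l' t where w: "w = (s, l', t)" by (cases w)
    show ?case
    proof (cases "s = u \<and> t = u \<and> path_class w \<noteq> \<zero>\<^bsub>A\<^esub>")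
      case False
      \<comment> \<open>The trivial path at \<open>u\<close> is closed and its class is nonzero, as
        \<open>\<chi> u\<close> takes the value \<open>1\<close> on it; so \<open>w\<close> is
        another path and contributes zero to both sides.\<close>
      have "w \<noteq> (u, [], u)"
      proof
        assume "w = (u, [], u)"
        then have "e u = \<zero>\<^bsub>A\<^esub>" using False by (simp add: w e_def)
        then show False using A.\<chi>_e[OF u u] A.\<chi>_zero[OF u] by simp
      qed
      then have "\<chi> u (path_class w) = 0" using path by (simp add: \<chi>_path_class)
      moreover have "A.pc u (path_class w) u = \<zero>\<^bsub>A\<^esub>"
        using False pc_path_class[OF path[unfolded w] u u] unfolding w by metis
      ultimately show ?thesis
        using c by (simp add: A.smult_zero_left)
    next
      case True
      show ?thesis
      proof (cases "l' = []")
        case True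
        then show ?thesis
          using \<open>s = u \<and> t = u \<and> _\<close> path u c *(6,7)
          by (simp add: w pc_path_class \<chi>_path_class A.smult_one path_class_mult)
      next
        case False
        then obtain p' r' where w': "l' = map Orig p' @ map Star r'" "p' \<noteq> []" "r' \<noteq> []"
          using nonzero_closed_pathE[of u l'] path True unfolding w by metis
        \<comment> \<open>Splitting off the arrows at the junctions exhibits the forbidden pattern:
          the last starred arrow of \<open>r\<close> meets the first original arrow of
          \<open>p'\<close>, and the last starred arrow of \<open>r'\<close> meets the first
          original arrow of \<open>p\<close>.\<close>
        obtain \<beta> r0 where r: "r = r0 @ [\<beta>]" using *(3) by (cases r rule: rev_cases) auto
        obtain \<beta>' r1 where r': "r' = r1 @ [\<beta>']" using w'(3) by (cases r' rule: rev_cases) auto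
        obtain \<alpha> p0 where p: "p = \<alpha> # p0" using *(2) by (cases p) auto
        obtain \<alpha>' p1 where p': "p' = \<alpha>' # p1" using w'(2) by (cases p') auto
        have "(m, map Star r @ l', u) \<in> paths (dual_quiver \<Gamma>)"
          "(u, l' @ map Orig p, m) \<in> paths (dual_quiver \<Gamma>)"
          using dual.paths_append *(6,7) path True by (auto simp: w)
        then have "path_class (m, map Star r @ l', u) = \<zero>\<^bsub>A\<^esub>"
          "path_class (u, l' @ map Orig p, m) = \<zero>\<^bsub>A\<^esub>"
          using path_class_zero[of m "map Star r0" \<beta> \<alpha>' "map Orig p1 @ map Star r'" u]
            path_class_zero[of u "map Orig p' @ map Star r1" \<beta>' \<alpha> "map Orig p0" m]
          by (simp_all add: w'(1) r r' p p')
        then show ?thesis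
          using True False path u c *(6,7)
          by (simp add: w pc_path_class \<chi>_path_class A.smult_zero_left path_class_mult)
      qed
    qed
  qed (use u c in \<open>simp_all add: A.pc_add A.pc_smult A.l_distr A.r_distr A.smult_mult_left A.smult_mult_right
      A.\<chi>_add A.\<chi>_smult A.\<chi>_zero A.smult_l_distr A.smult_assoc A.smult_zero_left A.pc_def[of _ "\<zero>\<^bsub>A\<^esub>"]\<close>)
  have "\<forall>x\<in>A.peirce u m. ?p \<otimes>\<^bsub>A\<^esub> x = \<zero>\<^bsub>A\<^esub>"
    using p_zero peirce_pc A.peirceD(1) by metis
  moreover have "\<forall>x\<in>A.peirce m u. x \<otimes>\<^bsub>A\<^esub> ?q = \<zero>\<^bsub>A\<^esub>"
    using q_zero peirce_pc A.peirceD(1) by metis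
  moreover have "\<forall>x\<in>A.peirce u u. x \<otimes>\<^bsub>A\<^esub> ?q = \<chi> u x \<odot>\<^bsub>A\<^esub> ?q \<and> ?p \<otimes>\<^bsub>A\<^esub> x = \<chi> u x \<odot>\<^bsub>A\<^esub> ?p"
    using act peirce_pc A.peirceD(1) by metis
  ultimately show ?thesis
    unfolding A.loops_def using prod pq *(4,5) by blast
qed

text \<open>Zero is removed from the spanning set because the description of nontrivial closed paths
  as loops is for nonzero classes; the induction principle recovers vanishing classes from its zero
  case.\<close>

lemma folded_kalgebra_dual_extension:
  "folded_kalgebra A (verts \<Gamma>) e \<chi> (path_class ` paths (dual_quiver \<Gamma>) - {\<zero>\<^bsub>A\<^esub>})"
proof
  show "path_class ` paths (dual_quiver \<Gamma>) - {\<zero>\<^bsub>A\<^esub>} \<subseteq> carrier A"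
    using path_class_closed by auto
next
  fix b assume "b \<in> path_class ` paths (dual_quiver \<Gamma>) - {\<zero>\<^bsub>A\<^esub>}"
  then obtain u l v where b: "b = path_class (u, l, v)" "(u, l, v) \<in> paths (dual_quiver \<Gamma>)" "b \<noteq> \<zero>\<^bsub>A\<^esub>"
    by auto
  note ends = path_ends[OF b(2)]
  consider "u \<noteq> v" | "u = v" "l = []" | "u = v" "l \<noteq> []" by blast
  then show "(\<exists>i\<in>verts \<Gamma>. b = e i) \<or>
      (\<exists>i\<in>verts \<Gamma>. \<exists>j\<in>verts \<Gamma>. i \<noteq> j \<and> b \<in> A.peirce i j) \<or> (\<exists>i\<in>verts \<Gamma>. b \<in> A.loops i)"
  proof cases
    case 1
    then show ?thesis using b(1) path_class_peirce[OF b(2)] ends by metis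
  next
    case 2
    then show ?thesis using b(1) ends by (auto simp: e_def)
  next
    case 3
    then show ?thesis using b ends closed_path_class_loop by metis
  qed
next
  fix x Q
  assume "x \<in> carrier A" and zero: "Q \<zero>\<^bsub>A\<^esub>"
    and basis: "\<And>b. b \<in> path_class ` paths (dual_quiver \<Gamma>) - {\<zero>\<^bsub>A\<^esub>} \<Longrightarrow> Q b"
    and "\<And>x y. x \<in> carrier A \<Longrightarrow> y \<in> carrier A \<Longrightarrow> Q x \<Longrightarrow> Q y \<Longrightarrow> Q (x \<oplus>\<^bsub>A\<^esub> y)"
    and "\<And>c x. x \<in> carrier A \<Longrightarrow> Q x \<Longrightarrow> Q (c \<odot>\<^bsub>A\<^esub> x)"
  then show "Q x"
  proof (induction rule: path_span_induct)
    case (path w)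
    then show ?case using zero basis by (cases "path_class w = \<zero>\<^bsub>A\<^esub>") auto
  qed auto
qed

end

section \<open>The theorem for fields of characteristic other than two\<close>

lemma two_neq_zero_of_char:
  assumes "CHAR('k::field) \<noteq> 2" shows "(2::'k) \<noteq> 0"
proof
  assume "(2::'k) = 0"
  then have "of_nat 2 = (0::'k)" by simp
  then have "CHAR('k) dvd 2" by (simp only: of_nat_eq_0_iff_char_dvd)
  then have "CHAR('k) = 1"
    using assms by (metis dvd_imp_le le_neq_implies_less less_2_cases dvd_0_left_iff zero_neq_numeral zero_less_numeral One_nat_def)
  then show False by (simp add: CHAR_not_1)
qed

text \<open>Uniqueness means agreement on the carrier, since maps are arbitrary outside it.\<close>

theorem mainTheorem1:
  fixes \<Gamma> :: "('v, 'a) pre_digraph"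
    and \<rho> :: "('v, 'a, 'k::field) path_comb set"
    and \<Theta> :: "('v, 'a dual_arrow, 'k) path_comb set \<Rightarrow> ('v, 'a dual_arrow, 'k) path_comb set"
  assumes "CHAR('k) \<noteq> 2"
    and "fin_digraph \<Gamma>"
    and "\<not> (\<exists>p. wf_digraph.closed_w \<Gamma> p)"
    and "\<forall>r\<in>\<rho>. is_relation \<Gamma> r"
    and "lie_derivation (dual_extension \<Gamma> \<rho>) \<Theta>"
  shows "(\<exists>D \<Delta>. standard_decomposition (dual_extension \<Gamma> \<rho>) \<Theta> D \<Delta>) \<and>
    (\<forall>D \<Delta> D' \<Delta>'.
       standard_decomposition (dual_extension \<Gamma> \<rho>) \<Theta> D \<Delta> \<longrightarrow>
       standard_decomposition (dual_extension \<Gamma> \<rho>) \<Theta> D' \<Delta>' \<longrightarrow>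
       (\<forall>x\<in>carrier (dual_extension \<Gamma> \<rho>). D x = D' x \<and> \<Delta> x = \<Delta>' x))"
proof -
  interpret acyclic_quiver \<Gamma> \<rho>
    using assms(2-4) by (intro acyclic_quiver.intro acyclic_quiver_axioms.intro)
  interpret folded_kalgebra A "verts \<Gamma>" e \<chi> "path_class ` paths (dual_quiver \<Gamma>) - {\<zero>\<^bsub>A\<^esub>}"
    by (rule folded_kalgebra_dual_extension)
  show ?thesis
  proof (intro conjI allI impI ballI)
    show "\<exists>D \<Delta>. standard_decomposition A \<Theta> D \<Delta>"
      by (rule lie_derivation_standard[OF two_neq_zero_of_char[OF assms(1)] assms(5)])
  qed (fact standard_decomposition_unique)+
qed

end
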